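(* Assume (Increments), (Waiting times), (Square integrability), (Full support) and (Growth) as described in the context. Let $\pi\in\mathcal{S}$ and, for any $\gamma\le0$, let $\pi^\gamma=\pi^\gamma(\pi)\in\mathcal{S}$ be the maximiser on the right-hand side of the Bellman equation $$\bar v^\gamma(\pi)=\sup_{\pi'\in\mathcal{S}}\Big(\ln s(\pi,\pi')-\bar\lambda^\gamma\,\mathbb{E}[\eta_1]+\mu^\gamma\big[\ln\langle \pi',R(\eta_1)\rangle+\bar v^\gamma(G(\pi',R(\eta_1)))\big]\Big),\qquad \pi\in\mathcal{S},$$ where $(\bar v^\gamma,\bar\lambda^\gamma)\in\mathcal{C}_b(\mathcal{S})\times\mathbb{R}$ is a solution with concave lift. Then $\pi^\gamma\to\pi^0$ as $\gamma\uparrow0$.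
   Context: Notation. $d\ge1$; $\langle x,y\rangle$ is the scalar product, $x\cdot y$ the component-wise product on $\mathbb{R}^d$; $\mathbf{1}=(1,\dots,1)$. $\mathcal{S}=\{\pi\in\mathbb{R}^d:\pi_i\ge0,\ \langle\pi,\mathbf{1}\rangle=1\}$, $\mathcal{S}_0=\{\pi\in\mathcal{S}:\pi_i>0\ \forall i\}$; $\mathcal{C}_b(\mathcal{S})$ is the space of bounded continuous real functions on $\mathcal{S}$. $G(x,y):=\frac{x\cdot y}{\langle x,y\rangle}$. Transaction costs. $c_i,h_i\in[0,1)$, $i=1,\dots,d$; $p(x):=\sum_{i=1}^d\max(c_ix_i,-h_ix_i)$; $\bar c:=\max_i\max(c_i,h_i)$; $\bar s:=\frac{1-\bar c}{1+\bar c}$. For $\pi,\pi'\in\mathcal{S}$, $s(\pi,\pi')$ denotes the unique $w>0$ with $w+p(w\pi'-\pi)=1$. Market. $S(t)=(S_1(t),\dots,S_d(t))$, $t\ge0$, is a process of strictly positive prices, $R(t_1,t_2)=(S_i(t_2)/S_i(t_1))_{i}$, $R(t)=R(0,t)$, $r(t)=\ln R(t)$ (component-wise). $(\eta_i)_{i\ge1}$ are i.i.d. $(0,\infty)$-valued random variables, independent of the price process. (Increments): $t\mapsto\ln S(t)$ is right-continuous and has stationary independent increments. (Waiting times): $\mathbb{P}[\eta_i>0]=1$ and $\mathbb{E}[\eta_i]<\infty$. (Square integrability): for any $\gamma<0$, $\mathbb{E}[e^{\gamma\min_i r_i(\eta_1)}]<\infty$, and $\mathbb{E}[(\max_i r_i(\eta_1))^2]<\infty$.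 (Full support): for any $\pi\in\mathcal{S}_0$, $t>0$ and any non-empty (relatively) open $C\subset\mathcal{S}$, $\mathbb{P}[G(\pi,R(t))\in C]>0$. (Growth): for any $\gamma\le0$, $i\in\{1,\dots,d\}$ and every $\pi'\in\mathcal{S}$ with $\pi'_i=0$, $$\frac{\mathbb{E}[R_i(\eta_1)\langle\pi',R(\eta_1)\rangle^{\gamma-1}]}{\mathbb{E}[\langle\pi',R(\eta_1)\rangle^{\gamma}]}>\bar s^{\,\gamma-1}(1+C),\qquad C:=\frac{2\Lambda}{\bar s},\quad \Lambda:=\frac{\bar c}{1-\bar c}$$ (the numerator is allowed to be $+\infty$). Entropic utility. $\mu^\gamma[Z]:=\frac1\gamma\ln\mathbb{E}[e^{\gamma Z}]$ for $\gamma<0$ and $\mu^0[Z]:=\mathbb{E}[Z]$. Concave lift. $v\in\mathcal{C}_b(\mathcal{S})$ has a concave lift if $\mathcal{W}_v(x):=\langle x,\mathbf{1}\rangle e^{v(x/\langle x,\mathbf{1}\rangle)}$ for $x\in\mathbb{R}^d_+\setminus\{\mathbf{0}\}$, $\mathcal{W}_v(\mathbf{0}):=0$, is concave on $\mathbb{R}^d_+$. Facts making $\pi^\gamma$ well defined under the conditions above: for each $\gamma\le0$ a solution of the Bellman equation with concave lift exists, the constant $\bar\lambda^\gamma$ is unique, $\bar v^\gamma$ is unique (among solutions with concave lift) up to an additive constant, and the maximiser is unique for each $\pi$. *)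

theory Defs
  imports "HOL-Probability.Probability"
begin

definition prob_simplex :: "(real^'d) set" where
  "prob_simplex = {\<pi>. (\<forall>i. 0 \<le> \<pi> $ i) \<and> \<pi> \<bullet> 1 = 1}"

definition open_prob_simplex :: "(real^'d) set" where
  "open_prob_simplex = {\<pi> \<in> prob_simplex. \<forall>i. 0 < \<pi> $ i}"

text \<open>The product and the unit \<open>1\<close> of \<^typ>\<open>real^'d\<close> are component-wise, so that
  \<open>x * y\<close> and \<open>1\<close> are the component-wise product and the all-ones vector.\<close>

definition renorm :: "real^'d \<Rightarrow> real^'d \<Rightarrow> real^'d" where
  "renorm x y = (x * y) /\<^sub>R (x \<bullet> y)"


subsection \<open>Transaction costs\<close>

definition cost_fun :: "real^'d \<Rightarrow> real^'d \<Rightarrow> real^'d \<Rightarrow> real" where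
  "cost_fun c h x = (\<Sum>i\<in>UNIV. max (c $ i * x $ i) (- (h $ i * x $ i)))"

definition c_bar :: "real^'d \<Rightarrow> real^'d \<Rightarrow> real" where
  "c_bar c h = (MAX i. max (c $ i) (h $ i))"

definition s_bar :: "real^'d \<Rightarrow> real^'d \<Rightarrow> real" where
  "s_bar c h = (1 - c_bar c h) / (1 + c_bar c h)"

definition shrinkage :: "real^'d \<Rightarrow> real^'d \<Rightarrow> real^'d \<Rightarrow> real^'d \<Rightarrow> real" where
  "shrinkage c h \<pi> \<pi>' = (THE w. w > 0 \<and> w + cost_fun c h (w *\<^sub>R \<pi>' - \<pi>) = 1)"


subsection \<open>Market\<close>

text \<open>Time is \<open>t \<ge> 0\<close> and the waiting times are \<open>\<eta> i\<close> with \<open>i \<ge> 1\<close>; the values of \<open>S\<close>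
  at negative times and of \<open>\<eta> 0\<close> are irrelevant.\<close>

locale market = prob_space M
  for M :: "'a measure" +
  fixes S :: "real \<Rightarrow> 'a \<Rightarrow> real^'d"
    and \<eta> :: "nat \<Rightarrow> 'a \<Rightarrow> real"
  assumes price_measurable: "\<And>t. t \<ge> 0 \<Longrightarrow> random_variable borel (S t)"
    and price_pos: "\<And>t \<omega> i. t \<ge> 0 \<Longrightarrow> \<omega> \<in> space M \<Longrightarrow> S t \<omega> $ i > 0"
    and waiting_pos: "\<And>i \<omega>. i \<ge> 1 \<Longrightarrow> \<omega> \<in> space M \<Longrightarrow> \<eta> i \<omega> > 0"
    and waiting_indep: "indep_vars (\<lambda>_. borel) \<eta> {1..}"
    and waiting_identical: "\<And>i. i \<ge> 1 \<Longrightarrow> distr M borel (\<eta> i) = distr M borel (\<eta> 1)"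
    and waiting_indep_price:
      "indep_set
         (sigma_sets (space M) {\<eta> i -` A \<inter> space M | i A. i \<ge> 1 \<and> A \<in> sets borel})
         (sigma_sets (space M) {S t -` A \<inter> space M | t A. t \<ge> 0 \<and> A \<in> sets borel})"

definition ln_vec :: "real^'d \<Rightarrow> real^'d" where
  "ln_vec x = (\<chi> i. ln (x $ i))"

definition ret :: "(real \<Rightarrow> 'a \<Rightarrow> real^'d) \<Rightarrow> real \<Rightarrow> real \<Rightarrow> 'a \<Rightarrow> real^'d" where
  "ret S t1 t2 \<omega> = (\<chi> i. S t2 \<omega> $ i / S t1 \<omega> $ i)"

definition wait_ret :: "(real \<Rightarrow> 'a \<Rightarrow> real^'d) \<Rightarrow> (nat \<Rightarrow> 'a \<Rightarrow> real) \<Rightarrow> 'a \<Rightarrow> real^'d" where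
  "wait_ret S \<eta> \<omega> = ret S 0 (\<eta> 1 \<omega>) \<omega>"

definition increments_cond :: "'a measure \<Rightarrow> (real \<Rightarrow> 'a \<Rightarrow> real^'d) \<Rightarrow> bool" where
  "increments_cond M S \<longleftrightarrow>
     (\<forall>\<omega>\<in>space M. \<forall>t\<ge>0. continuous (at_right t) (\<lambda>u. ln_vec (S u \<omega>))) \<and>
     (\<forall>t\<ge>0. \<forall>u\<ge>0. distr M borel (\<lambda>\<omega>. ln_vec (S (t + u) \<omega>) - ln_vec (S t \<omega>)) =
                   distr M borel (\<lambda>\<omega>. ln_vec (S u \<omega>) - ln_vec (S 0 \<omega>))) \<and>
     (\<forall>(t :: nat \<Rightarrow> real) n. 0 \<le> t 0 \<longrightarrow> (\<forall>k<n. t k < t (Suc k)) \<longrightarrow>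
        prob_space.indep_vars M (\<lambda>_. borel)
          (\<lambda>k \<omega>. ln_vec (S (t (Suc k)) \<omega>) - ln_vec (S (t k) \<omega>)) {..<n})"

definition waiting_times_cond :: "'a measure \<Rightarrow> (nat \<Rightarrow> 'a \<Rightarrow> real) \<Rightarrow> bool" where
  "waiting_times_cond M \<eta> \<longleftrightarrow>
     (\<forall>i\<ge>1. \<P>(\<omega> in M. \<eta> i \<omega> > 0) = 1 \<and> integrable M (\<eta> i))"

definition square_integrability_cond ::
    "'a measure \<Rightarrow> (real \<Rightarrow> 'a \<Rightarrow> real^'d) \<Rightarrow> (nat \<Rightarrow> 'a \<Rightarrow> real) \<Rightarrow> bool" where
  "square_integrability_cond M S \<eta> \<longleftrightarrow>
     (\<forall>\<gamma><0. integrable M (\<lambda>\<omega>. exp (\<gamma> * (MIN i. ln_vec (wait_ret S \<eta> \<omega>) $ i)))) \<and>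
     integrable M (\<lambda>\<omega>. (MAX i. ln_vec (wait_ret S \<eta> \<omega>) $ i)\<^sup>2)"

definition full_support_cond :: "'a measure \<Rightarrow> (real \<Rightarrow> 'a \<Rightarrow> real^'d) \<Rightarrow> bool" where
  "full_support_cond M S \<longleftrightarrow>
     (\<forall>\<pi>\<in>open_prob_simplex. \<forall>t>0. \<forall>C. openin (top_of_set prob_simplex) C \<longrightarrow> C \<noteq> {} \<longrightarrow>
        \<P>(\<omega> in M. renorm \<pi> (ret S 0 t \<omega>) \<in> C) > 0)"

text \<open>The expectations are taken in \<^typ>\<open>ennreal\<close> because the numerator may be infinite.\<close>

definition growth_cond ::
    "'a measure \<Rightarrow> (real \<Rightarrow> 'a \<Rightarrow> real^'d) \<Rightarrow> (nat \<Rightarrow> 'a \<Rightarrow> real) \<Rightarrow> real^'d \<Rightarrow> real^'d \<Rightarrow> bool" where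
  "growth_cond M S \<eta> c h \<longleftrightarrow>
     (let s = s_bar c h; \<Lambda> = c_bar c h / (1 - c_bar c h); C = 2 * \<Lambda> / s in
      \<forall>\<gamma>\<le>0. \<forall>i. \<forall>\<pi>'\<in>prob_simplex. \<pi>' $ i = 0 \<longrightarrow>
        (\<integral>\<^sup>+\<omega>. ennreal (wait_ret S \<eta> \<omega> $ i * (\<pi>' \<bullet> wait_ret S \<eta> \<omega>) powr (\<gamma> - 1)) \<partial>M) /
        (\<integral>\<^sup>+\<omega>. ennreal ((\<pi>' \<bullet> wait_ret S \<eta> \<omega>) powr \<gamma>) \<partial>M)
        > ennreal (s powr (\<gamma> - 1) * (1 + C)))"


subsection \<open>Bellman equation\<close>

text \<open>Below, \<open>Z\<close> (for \<open>\<gamma> = 0\<close>) and \<open>exp (\<gamma> * Z)\<close> (for \<open>\<gamma> < 0\<close>) are integrable under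
  \<^const>\<open>square_integrability_cond\<close>, so the real-valued integral is the expectation. For the
  same reason the supremum in the Bellman equation is one of a set that is bounded above.\<close>

definition entropic_utility :: "'a measure \<Rightarrow> real \<Rightarrow> ('a \<Rightarrow> real) \<Rightarrow> real" where
  "entropic_utility M \<gamma> Z =
     (if \<gamma> = 0 then (\<integral>\<omega>. Z \<omega> \<partial>M) else 1 / \<gamma> * ln (\<integral>\<omega>. exp (\<gamma> * Z \<omega>) \<partial>M))"

definition concave_lift :: "(real^'d \<Rightarrow> real) \<Rightarrow> real^'d \<Rightarrow> real" where
  "concave_lift v x = (if x = 0 then 0 else (x \<bullet> 1) * exp (v (x /\<^sub>R (x \<bullet> 1))))"

definition has_concave_lift :: "(real^'d \<Rightarrow> real) \<Rightarrow> bool" where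
  "has_concave_lift v \<longleftrightarrow> concave_on {x. \<forall>i. 0 \<le> x $ i} (concave_lift v)"

definition bellman_objective ::
    "'a measure \<Rightarrow> (real \<Rightarrow> 'a \<Rightarrow> real^'d) \<Rightarrow> (nat \<Rightarrow> 'a \<Rightarrow> real) \<Rightarrow> real^'d \<Rightarrow> real^'d \<Rightarrow> real \<Rightarrow>
     (real^'d \<Rightarrow> real) \<Rightarrow> real \<Rightarrow> real^'d \<Rightarrow> real^'d \<Rightarrow> real" where
  "bellman_objective M S \<eta> c h \<gamma> v lam \<pi> \<pi>' =
     ln (shrinkage c h \<pi> \<pi>') - lam * (\<integral>\<omega>. \<eta> 1 \<omega> \<partial>M) +
     entropic_utility M \<gamma>
       (\<lambda>\<omega>. ln (\<pi>' \<bullet> wait_ret S \<eta> \<omega>) + v (renorm \<pi>' (wait_ret S \<eta> \<omega>)))"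

text \<open>Only the values of \<open>v\<close> on the simplex matter.\<close>

definition bellman_solution ::
    "'a measure \<Rightarrow> (real \<Rightarrow> 'a \<Rightarrow> real^'d) \<Rightarrow> (nat \<Rightarrow> 'a \<Rightarrow> real) \<Rightarrow> real^'d \<Rightarrow> real^'d \<Rightarrow> real \<Rightarrow>
     (real^'d \<Rightarrow> real) \<Rightarrow> real \<Rightarrow> bool" where
  "bellman_solution M S \<eta> c h \<gamma> v lam \<longleftrightarrow>
     continuous_on prob_simplex v \<and> bounded (v ` prob_simplex) \<and>
     (\<forall>\<pi>\<in>prob_simplex.
        v \<pi> = (SUP \<pi>'\<in>prob_simplex. bellman_objective M S \<eta> c h \<gamma> v lam \<pi> \<pi>'))"

end

theory Submission imports Defs "HOL-Complex_Analysis.Great_Picard" begin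


text \<open>The proof is a compactness argument: the value functions for risk aversion \<open>\<gamma>\<close> near
  \<open>0\<close> form a relatively compact family, every limit point solves the equation for \<open>\<gamma> = 0\<close>,
  and that equation determines its solution up to an additive constant and has only one maximiser.

  Put \<open>J \<gamma> v \<pi> y = ln s(\<pi>,y) + \<mu>\<^sup>\<gamma>[ln \<langle>y,R\<rangle> + v(G(y,R))]\<close> and \<open>\<kappa> = \<lambda> E[\<eta>]\<close>, so that the
  Bellman equation reads \<open>v \<pi> + \<kappa> = sup\<^sub>y J \<gamma> v \<pi> y\<close>.

  Compactness. The current position \<open>\<pi>\<close> enters \<open>J\<close> only through \<open>ln s(\<pi>,y)\<close>. Hence differences of
  \<open>v\<close> are controlled by differences of \<open>ln s(\<cdot>,y)\<close>, which gives an oscillation bound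
  (\<open>bellman_oscillation\<close>) and a Lipschitz bound (\<open>bellman_Lipschitz\<close>) whose constants depend on the
  costs alone. By the theorem of Arzela and Ascoli the solutions, normalised to vanish at one point,
  have uniformly convergent subsequences. Dominated convergence, based on
  \<open>1 - e\<^sup>-\<^sup>z \<le> (e\<^sup>\<gamma>\<^sup>z - 1)/\<gamma> \<le> z\<close> for \<open>-1 \<le> \<gamma> < 0\<close>, carries the Bellman equation and its
  maximisers to the limit (\<open>tendsto_J\<close>, \<open>bellman_limit\<close>). The constants \<open>\<kappa>\<close> then converge
  automatically, because they are determined by \<open>v\<close> and a maximiser.

  Uniqueness for \<open>\<gamma> = 0\<close>. The payoff of \<open>y\<close> is \<open>ln W(y \<cdot> R)\<close>, where \<open>W\<close> is the concave, positively
  homogeneous lift of \<open>v\<close>, and \<open>ln s\<close> is absorbed by letting \<open>y\<close> range over the convex set of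
  affordable, not necessarily normalised, portfolios. Three facts follow.
  First, a maximiser holds every asset: if asset \<open>i\<close> is missing, buying a little of it is profitable by
  the growth condition (\<open>optimiser_interior\<close>).
  Secondly, if \<open>y\<^sub>1\<close> and \<open>y\<^sub>2\<close> are optimal, their midpoint is better unless
  \<open>W(y\<^sub>1 \<cdot> R) = W(y\<^sub>2 \<cdot> R)\<close> almost surely; as the direction of \<open>y\<^sub>1 \<cdot> R\<close> has full support, \<open>W(x) = W(a \<cdot> x)\<close> for every
  \<open>x\<close> with \<open>a = y\<^sub>2/y\<^sub>1\<close>, and the unit vectors give \<open>a = 1\<close> (\<open>optimiser_unique\<close>).
  Thirdly, compare two solutions \<open>v\<^sub>1, v\<^sub>2\<close> where \<open>v\<^sub>1 - v\<^sub>2\<close> is maximal: the constants must agree, and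
  \<open>v\<^sub>1 - v\<^sub>2\<close> must be maximal almost surely after one more step, hence everywhere by full support
  (\<open>bellman_unique\<close>).

  Full support is a property of the prices at deterministic times, but the arguments above use it at
  the random time \<open>\<eta> 1\<close>. The transfer (\<open>full_support_at_waiting_time\<close>) holds because the waiting time
  is independent of the right-continuous price process.\<close>

section \<open>The simplex\<close>

lemma inner_one: "x \<bullet> (1 :: real^'d) = (\<Sum>i\<in>UNIV. x $ i)"
  by (simp add: inner_vec_def)

definition l1_norm :: "real^'d \<Rightarrow> real" where
  "l1_norm x = (\<Sum>i\<in>UNIV. \<bar>x $ i\<bar>)"

lemma l1_norm_nonneg: "0 \<le> l1_norm x"
  by (simp add: l1_norm_def sum_nonneg)

lemma l1_norm_scaleR: "l1_norm (a *\<^sub>R x) = \<bar>a\<bar> * l1_norm x"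
  by (simp add: l1_norm_def abs_mult sum_distrib_left)

lemma l1_norm_triangle: "l1_norm (x + y) \<le> l1_norm x + l1_norm y"
  by (simp add: l1_norm_def sum.distrib[symmetric] sum_mono abs_triangle_ineq)

lemma l1_norm_le_norm: "l1_norm (x :: real^'d) \<le> CARD('d) * norm x"
proof -
  have "l1_norm x \<le> (\<Sum>i\<in>(UNIV::'d set). norm x)"
    unfolding l1_norm_def by (intro sum_mono) (simp add: component_le_norm_cart)
  then show ?thesis by simp
qed

lemma l1_norm_nonneg_vec: "(\<And>i. 0 \<le> x $ i) \<Longrightarrow> l1_norm x = x \<bullet> 1"
  by (simp add: l1_norm_def inner_one)

lemma l1_norm_simplex: "x \<in> prob_simplex \<Longrightarrow> l1_norm x = 1"
  by (simp add: prob_simplex_def l1_norm_nonneg_vec)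

lemma simplexD: "x \<in> prob_simplex \<Longrightarrow> 0 \<le> x $ i" "x \<in> prob_simplex \<Longrightarrow> x \<bullet> 1 = 1"
  by (simp_all add: prob_simplex_def)

lemma compact_prob_simplex: "compact (prob_simplex :: (real^'d) set)"
proof -
  have "closed (prob_simplex :: (real^'d) set)"
    unfolding prob_simplex_def
    by (intro closed_Collect_conj closed_Collect_all closed_Collect_le closed_Collect_eq
          continuous_intros)
  moreover have "norm x \<le> 1" if "x \<in> prob_simplex" for x :: "real^'d"
    using norm_le_l1_cart[of x] l1_norm_simplex[OF that] by (simp add: l1_norm_def)
  then have "bounded (prob_simplex :: (real^'d) set)"
    by (auto simp: bounded_iff)
  ultimately show ?thesis by (simp add: compact_eq_bounded_closed)
qed

lemma axis_in_simplex: "axis i 1 \<in> (prob_simplex :: (real^'d) set)"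
  by (auto simp: prob_simplex_def inner_one axis_def)

lemma prob_simplex_nonempty: "(prob_simplex :: (real^'d) set) \<noteq> {}"
  using axis_in_simplex by blast

lemma normalise_in_simplex:
  assumes "\<And>i. 0 \<le> y $ i" "y \<noteq> 0"
  shows "0 < y \<bullet> 1" "y /\<^sub>R (y \<bullet> 1) \<in> prob_simplex"
proof -
  have "y \<bullet> 1 = l1_norm y" using assms(1) by (simp add: l1_norm_nonneg_vec)
  moreover have "0 < norm y" using assms(2) by simp
  ultimately show *: "0 < y \<bullet> 1"
    using norm_le_l1_cart[of y] unfolding l1_norm_def by linarith
  show "y /\<^sub>R (y \<bullet> 1) \<in> prob_simplex"
    using assms * by (auto simp: prob_simplex_def)
qed

section \<open>Transaction costs\<close>

locale transaction_costs =
  fixes c h :: "real^'d"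
  assumes c_range: "c $ i \<in> {0..<1}" and h_range: "h $ i \<in> {0..<1}"
begin

lemma c_le: "c $ i \<le> c_bar c h" and h_le: "h $ i \<le> c_bar c h"
proof -
  have "max (c $ i) (h $ i) \<le> c_bar c h"
    unfolding c_bar_def by (rule Max_ge) auto
  then show "c $ i \<le> c_bar c h" "h $ i \<le> c_bar c h" by auto
qed

lemma c_bar_range: "0 \<le> c_bar c h" "c_bar c h < 1"
proof -
  show "0 \<le> c_bar c h" using c_range[of undefined] c_le[of undefined] by auto
  show "c_bar c h < 1" unfolding c_bar_def using c_range h_range by (subst Max_less_iff) auto
qed

lemma s_bar_range: "0 < s_bar c h" "s_bar c h \<le> 1"
  using c_bar_range by (auto simp: s_bar_def)

lemma cost_nonneg: "0 \<le> cost_fun c h x"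
  unfolding cost_fun_def
proof (rule sum_nonneg)
  fix i
  show "0 \<le> max (c $ i * x $ i) (- (h $ i * x $ i))"
    using c_range[of i] h_range[of i]
    by (cases "0 \<le> x $ i") (auto simp: le_max_iff_disj mult_le_0_iff)
qed

lemma cost_triangle: "cost_fun c h (x + y) \<le> cost_fun c h x + cost_fun c h y"
  unfolding cost_fun_def sum.distrib[symmetric]
  by (intro sum_mono) (simp add: algebra_simps, linarith)

lemma cost_scaleR: "0 \<le> a \<Longrightarrow> cost_fun c h (a *\<^sub>R x) = a * cost_fun c h x"
  unfolding cost_fun_def sum_distrib_left
  by (intro sum.cong) (simp_all add: max_mult_distrib_left mult.left_commute)

lemma cost_le_l1: "cost_fun c h x \<le> c_bar c h * l1_norm x"
  unfolding cost_fun_def l1_norm_def sum_distrib_left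
proof (rule sum_mono)
  fix i
  have "c $ i * x $ i \<le> c $ i * \<bar>x $ i\<bar>" "- (h $ i * x $ i) \<le> h $ i * \<bar>x $ i\<bar>"
    using c_range[of i] h_range[of i] mult_left_mono[of "- x $ i" "\<bar>x $ i\<bar>" "h $ i"]
    by (auto intro: mult_left_mono)
  moreover have "c $ i * \<bar>x $ i\<bar> \<le> c_bar c h * \<bar>x $ i\<bar>" "h $ i * \<bar>x $ i\<bar> \<le> c_bar c h * \<bar>x $ i\<bar>"
    using c_le h_le by (auto intro: mult_right_mono)
  ultimately show "max (c $ i * x $ i) (- (h $ i * x $ i)) \<le> c_bar c h * \<bar>x $ i\<bar>"
    by linarith
qed

lemma cost_Lipschitz: "cost_fun c h x - cost_fun c h y \<le> c_bar c h * l1_norm (x - y)"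
  using cost_triangle[of "x - y" y] cost_le_l1[of "x - y"] by simp

text \<open>The cost function is Lipschitz with constant \<open>c_bar c h < 1\<close> in the \<open>l1\<close> norm, so the
  cost of a trade cannot outweigh the wealth traded. This makes the left-hand side of the
  equation for the shrinkage factor strictly increasing in the factor.\<close>

lemma budget_increasing:
  assumes "\<pi>' \<in> prob_simplex" "w \<le> w'"
  shows "(1 - c_bar c h) * (w' - w) \<le>
    (w' + cost_fun c h (w' *\<^sub>R \<pi>' - \<pi>)) - (w + cost_fun c h (w *\<^sub>R \<pi>' - \<pi>))"
proof -
  have "w *\<^sub>R \<pi>' - \<pi> - (w' *\<^sub>R \<pi>' - \<pi>) = (w - w') *\<^sub>R \<pi>'" by (simp add: algebra_simps)
  then have "cost_fun c h (w *\<^sub>R \<pi>' - \<pi>) - cost_fun c h (w' *\<^sub>R \<pi>' - \<pi>) \<le> c_bar c h * (w' - w)"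
    using cost_Lipschitz[of "w *\<^sub>R \<pi>' - \<pi>" "w' *\<^sub>R \<pi>' - \<pi>"] assms
    by (simp add: l1_norm_scaleR l1_norm_simplex)
  then show ?thesis by (simp add: algebra_simps)
qed

lemma continuous_on_cost: "continuous_on A (cost_fun c h)"
  unfolding cost_fun_def by (intro continuous_intros)

lemma shrinkage_ex1:
  assumes "\<pi> \<in> prob_simplex" "\<pi>' \<in> prob_simplex"
  shows "\<exists>!w. w > 0 \<and> w + cost_fun c h (w *\<^sub>R \<pi>' - \<pi>) = 1"
proof -
  let ?f = "\<lambda>w. w + cost_fun c h (w *\<^sub>R \<pi>' - \<pi>)"
  have 0: "?f 0 < 1"
    using cost_le_l1[of "- \<pi>"] c_bar_range l1_norm_scaleR[of "-1" \<pi>]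
    by (simp add: l1_norm_simplex assms)
  have 1: "1 \<le> ?f 1" using cost_nonneg by simp
  have "continuous_on {0..1} ?f"
    by (intro continuous_intros continuous_on_compose2[OF continuous_on_cost[of UNIV]]) auto
  then obtain w where w: "0 \<le> w" "?f w = 1"
    using IVT'[of ?f 0 1 1] 0 1 by auto
  moreover have "w \<noteq> 0" using 0 w by auto
  moreover have "v = u" if "?f v = 1" "?f u = 1" "v \<le> u" for u v
    using budget_increasing[OF assms(2) that(3), of \<pi>] that c_bar_range
    by (simp add: mult_le_0_iff)
  then have "v = u" if "?f v = 1" "?f u = 1" for u v
    using that by (metis nle_le)
  ultimately show ?thesis by (metis (no_types, lifting) less_eq_real_def)
qed

lemma
  assumes "\<pi> \<in> prob_simplex" "\<pi>' \<in> prob_simplex"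
  shows shrinkage_pos: "0 < shrinkage c h \<pi> \<pi>'"
    and shrinkage_eq: "shrinkage c h \<pi> \<pi>' + cost_fun c h (shrinkage c h \<pi> \<pi>' *\<^sub>R \<pi>' - \<pi>) = 1"
  using theI'[OF shrinkage_ex1[OF assms]] unfolding shrinkage_def by auto

text \<open>Monotonicity of the budget turns the budget equation into an optimality statement: the shrinkage
  factor is the largest multiple of \<open>\<pi>'\<close> that can be afforded.\<close>

lemma feasible_le_shrinkage:
  assumes "\<pi> \<in> prob_simplex" "\<pi>' \<in> prob_simplex"
    and "w + cost_fun c h (w *\<^sub>R \<pi>' - \<pi>) \<le> 1"
  shows "w \<le> shrinkage c h \<pi> \<pi>'"
proof (rule ccontr)
  assume "\<not> ?thesis"
  then have "shrinkage c h \<pi> \<pi>' < w" by simp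
  then have "0 < (1 - c_bar c h) * (w - shrinkage c h \<pi> \<pi>')" using c_bar_range by simp
  with budget_increasing[OF assms(2), of "shrinkage c h \<pi> \<pi>'" w \<pi>] shrinkage_eq[OF assms(1,2)]
    assms(3) \<open>shrinkage c h \<pi> \<pi>' < w\<close>
  show False by simp
qed

lemma shrinkage_le_1:
  assumes "\<pi> \<in> prob_simplex" "\<pi>' \<in> prob_simplex"
  shows "shrinkage c h \<pi> \<pi>' \<le> 1"
  using shrinkage_eq[OF assms] cost_nonneg by (metis le_add_same_cancel1)

lemma shrinkage_ge:
  assumes "\<pi> \<in> prob_simplex" "\<pi>' \<in> prob_simplex"
  shows "s_bar c h \<le> shrinkage c h \<pi> \<pi>'"
proof (rule feasible_le_shrinkage[OF assms])
  have "l1_norm (s_bar c h *\<^sub>R \<pi>' - \<pi>) \<le> s_bar c h + 1"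
    using l1_norm_triangle[of "s_bar c h *\<^sub>R \<pi>'" "- \<pi>"] l1_norm_scaleR[of "-1" \<pi>] s_bar_range assms
    by (simp add: l1_norm_scaleR l1_norm_simplex)
  then have "s_bar c h + cost_fun c h (s_bar c h *\<^sub>R \<pi>' - \<pi>) \<le> s_bar c h + c_bar c h * (s_bar c h + 1)"
    using cost_le_l1[of "s_bar c h *\<^sub>R \<pi>' - \<pi>"] c_bar_range
    by (smt (verit) mult_left_mono)
  \<comment> \<open>The value of \<open>s_bar\<close> is the one that makes this worst-case budget exact.\<close>
  also have "\<dots> = s_bar c h * (1 + c_bar c h) + c_bar c h" by (simp add: algebra_simps)
  also have "\<dots> = 1" using c_bar_range by (simp add: s_bar_def)
  finally show "s_bar c h + cost_fun c h (s_bar c h *\<^sub>R \<pi>' - \<pi>) \<le> 1" .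
qed

text \<open>Subtracting the two budget equations, the difference of the factors is at most the difference of
  the costs. The part of the latter caused by the factors themselves is absorbed on the left because
  the Lipschitz constant of the cost function is below 1.\<close>

lemma shrinkage_Lipschitz:
  assumes \<pi>: "\<pi>1 \<in> prob_simplex" "\<pi>2 \<in> prob_simplex" and ab: "a \<in> prob_simplex" "b \<in> prob_simplex"
  shows "shrinkage c h \<pi>1 a - shrinkage c h \<pi>2 b \<le>
    c_bar c h / (1 - c_bar c h) * (l1_norm (\<pi>1 - \<pi>2) + l1_norm (b - a))"
proof -
  define w1 where "w1 = shrinkage c h \<pi>1 a"
  define w2 where "w2 = shrinkage c h \<pi>2 b"
  have w: "0 < w1" "0 < w2" "w2 \<le> 1" "w1 + cost_fun c h (w1 *\<^sub>R a - \<pi>1) = 1"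
     "w2 + cost_fun c h (w2 *\<^sub>R b - \<pi>2) = 1"
    using assms by (simp_all add: w1_def w2_def shrinkage_pos shrinkage_eq shrinkage_le_1)
  let ?r = "l1_norm (\<pi>1 - \<pi>2) + l1_norm (b - a)"
  have r: "0 \<le> ?r" by (simp add: l1_norm_nonneg)
  have "w1 - w2 = cost_fun c h (w2 *\<^sub>R b - \<pi>2) - cost_fun c h (w1 *\<^sub>R a - \<pi>1)" using w by simp
  also have "\<dots> \<le> c_bar c h * l1_norm (w2 *\<^sub>R b - \<pi>2 - (w1 *\<^sub>R a - \<pi>1))"
    by (rule cost_Lipschitz)
  also have "w2 *\<^sub>R b - \<pi>2 - (w1 *\<^sub>R a - \<pi>1) = (w2 *\<^sub>R (b - a) + (w2 - w1) *\<^sub>R a) + (\<pi>1 - \<pi>2)"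
    by (simp add: algebra_simps)
  also have "l1_norm \<dots> \<le> l1_norm (w2 *\<^sub>R (b - a)) + l1_norm ((w2 - w1) *\<^sub>R a) + l1_norm (\<pi>1 - \<pi>2)"
    using l1_norm_triangle[of "w2 *\<^sub>R (b - a) + (w2 - w1) *\<^sub>R a" "\<pi>1 - \<pi>2"]
       l1_norm_triangle[of "w2 *\<^sub>R (b - a)" "(w2 - w1) *\<^sub>R a"] by linarith
  also have "\<dots> \<le> \<bar>w2 - w1\<bar> + ?r"
    using w mult_right_mono[OF w(3) l1_norm_nonneg[of "b - a"]] ab
    by (simp add: l1_norm_scaleR l1_norm_simplex)
  finally have *: "w1 - w2 \<le> c_bar c h * (\<bar>w2 - w1\<bar> + ?r)"
    using c_bar_range by (simp add: mult_left_mono)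
  show ?thesis unfolding w1_def[symmetric] w2_def[symmetric]
  proof (cases "w1 \<le> w2")
    case True
    have "0 \<le> c_bar c h / (1 - c_bar c h) * ?r" using c_bar_range r by simp
    with True show "w1 - w2 \<le> c_bar c h / (1 - c_bar c h) * ?r" by linarith
  next
    case False
    then have "(1 - c_bar c h) * (w1 - w2) \<le> c_bar c h * ?r" using * by (simp add: algebra_simps)
    then show "w1 - w2 \<le> c_bar c h / (1 - c_bar c h) * ?r"
      using c_bar_range by (simp add: field_simps)
  qed
qed

lemma tendsto_shrinkage:
  assumes "\<pi> \<in> prob_simplex" "\<And>n. x n \<in> prob_simplex" "y \<in> prob_simplex" "x \<longlonglongrightarrow> y"
  shows "(\<lambda>n. shrinkage c h \<pi> (x n)) \<longlonglongrightarrow> shrinkage c h \<pi> y"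
proof -
  define L where "L = c_bar c h / (1 - c_bar c h) * CARD('d)"
  have Lam: "0 \<le> c_bar c h / (1 - c_bar c h)" using c_bar_range by simp
  have l0: "l1_norm (0 :: real^'d) = 0" by (simp add: l1_norm_def)
  have B: "shrinkage c h \<pi> a - shrinkage c h \<pi> b \<le> L * norm (b - a)"
    if "a \<in> prob_simplex" "b \<in> prob_simplex" for a b
    using shrinkage_Lipschitz[OF assms(1,1) that] mult_left_mono[OF l1_norm_le_norm[of "b - a"] Lam]
    by (simp add: L_def l0 mult.assoc)
  have "norm (shrinkage c h \<pi> (x n) - shrinkage c h \<pi> y) \<le> L * norm (x n - y)" for n
    using B[of "x n" y] B[of y "x n"] assms(2,3) by (simp add: abs_le_iff norm_minus_commute)
  moreover have "(\<lambda>n. L * norm (x n - y)) \<longlonglongrightarrow> 0"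
    using assms(4) by (intro tendsto_mult_right_zero tendsto_norm_zero LIM_zero)
  ultimately have "(\<lambda>n. shrinkage c h \<pi> (x n) - shrinkage c h \<pi> y) \<longlonglongrightarrow> 0"
    by (rule Lim_null_comparison[OF always_eventually, OF allI])
  then show ?thesis by (rule LIM_zero_cancel)
qed

end



section \<open>Measurability and limits of component-wise products\<close>

lemma borel_measurable_vec_component:
  "f \<in> borel_measurable M \<Longrightarrow> (\<lambda>\<omega>. (f \<omega> :: real^'d) $ i) \<in> borel_measurable M"
  unfolding cart_eq_inner_axis by (intro borel_measurable_inner borel_measurable_const)

lemma borel_measurable_vecI:
  fixes f :: "'a \<Rightarrow> real^'d"
  assumes "\<And>i. (\<lambda>\<omega>. f \<omega> $ i) \<in> borel_measurable M"
  shows "f \<in> borel_measurable M"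
proof (rule borel_measurable_euclidean_space[THEN iffD2, rule_format])
  fix b :: "real^'d"
  assume "b \<in> Basis"
  then obtain i where b: "b = axis i 1" unfolding Basis_vec_def by auto
  show "(\<lambda>\<omega>. f \<omega> \<bullet> b) \<in> borel_measurable M"
    unfolding b cart_eq_inner_axis[symmetric] by (rule assms)
qed

lemma borel_measurable_vec_mult:
  fixes f g :: "'a \<Rightarrow> real^'d"
  assumes "f \<in> borel_measurable M" "g \<in> borel_measurable M"
  shows "(\<lambda>\<omega>. f \<omega> * g \<omega>) \<in> borel_measurable M"
  by (rule borel_measurable_vecI)
     (simp add: borel_measurable_times borel_measurable_vec_component assms)

lemma tendsto_vec_mult:
  fixes f g :: "'a \<Rightarrow> real^'d"
  assumes "(f \<longlongrightarrow> a) F" "(g \<longlongrightarrow> b) F"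
  shows "((\<lambda>x. f x * g x) \<longlongrightarrow> a * b) F"
  by (rule vec_tendstoI) (auto intro!: tendsto_intros assms)

lemma borel_measurable_continuous_on_simplex:
  fixes v :: "real^'d \<Rightarrow> real"
  assumes v: "continuous_on prob_simplex v" and f: "f \<in> borel_measurable M"
    and ran: "\<And>\<omega>. \<omega> \<in> space M \<Longrightarrow> f \<omega> \<in> prob_simplex"
  shows "(\<lambda>\<omega>. v (f \<omega>)) \<in> borel_measurable M"
proof -
  have "(\<lambda>x. indicator prob_simplex x *\<^sub>R v x) \<in> borel_measurable borel"
    by (rule borel_measurable_continuous_on_indicator[OF _ v])
       (simp add: borel_compact compact_prob_simplex)
  from measurable_compose[OF f this] show ?thesis
    by (rule measurable_cong[THEN iffD1, rotated]) (simp add: ran)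
qed

section \<open>Entropic utility for vanishing risk aversion\<close>

text \<open>The continuous extension of \<open>(e\<^sup>u - 1)/u\<close>. Written with it, \<open>(e\<^sup>g\<^sup>z - 1)/g\<close> becomes
  \<open>z * exp_quotient (g * z)\<close>, an expression that also covers the case \<open>g = 0\<close>.\<close>

definition exp_quotient :: "real \<Rightarrow> real" where
  "exp_quotient u = (if u = 0 then 1 else (exp u - 1) / u)"

lemma exp_quotient_mult: "exp u - 1 = u * exp_quotient u"
  by (simp add: exp_quotient_def)

lemma tendsto_exp_quotient: "(exp_quotient \<longlongrightarrow> 1) (nhds 0)"
proof -
  have "((\<lambda>u. (exp u - 1) / u) \<longlongrightarrow> (1::real)) (at 0)" by (rule lim_exp_minus_1)
  then have "(exp_quotient \<longlongrightarrow> 1) (at 0)"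
    by (rule tendsto_cong[THEN iffD1, rotated])
       (auto simp: exp_quotient_def eventually_at_filter)
  then show ?thesis by (simp add: tendsto_nhds_iff exp_quotient_def)
qed

text \<open>The upper bound is \<open>1 + u \<le> e\<^sup>u\<close>; the lower bound is convexity of the exponential function
  between \<open>0\<close> and \<open>- z\<close>. Neither bound involves \<open>g\<close>, so they provide a common majorant.\<close>

lemma exp_quotient_bounds:
  assumes "-1 \<le> g" "g \<le> 0"
  shows "1 - exp (- z) \<le> z * exp_quotient (g * z)" "z * exp_quotient (g * z) \<le> z"
proof -
  have "1 - exp (- z) \<le> z * exp_quotient (g * z) \<and> z * exp_quotient (g * z) \<le> z"
  proof (cases "g = 0")
    case True
    then show ?thesis
      using exp_ge_add_one_self[of "- z"] by (auto simp: exp_quotient_def algebra_simps)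
  next
    case False
    with assms have "g < 0" by simp
    have eq: "z * exp_quotient (g * z) = (exp (g * z) - 1) / g"
      using exp_quotient_mult[of "g * z"] \<open>g < 0\<close> by (simp add: field_simps)
    have "exp ((1 - (- g)) *\<^sub>R 0 + (- g) *\<^sub>R (- z)) \<le> (1 - (- g)) * exp 0 + (- g) * exp (- z)"
      by (rule convex_onD[OF exp_convex]) (use assms in auto)
    then have "exp (g * z) - 1 \<le> (1 - exp (- z)) * g" by (simp add: algebra_simps)
    then have "1 - exp (- z) \<le> z * exp_quotient (g * z)"
      using \<open>g < 0\<close> by (simp add: eq neg_le_divide_eq)
    moreover have "g * z \<le> exp (g * z) - 1"
      using exp_ge_add_one_self[of "g * z"] by linarith
    then have "z * exp_quotient (g * z) \<le> z"
      using \<open>g < 0\<close> by (simp add: eq neg_divide_le_eq mult.commute)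
    ultimately show ?thesis ..
  qed
  then show "1 - exp (- z) \<le> z * exp_quotient (g * z)" "z * exp_quotient (g * z) \<le> z" by auto
qed

definition ln_quotient :: "real \<Rightarrow> real" where
  "ln_quotient u = (if u = 0 then 1 else ln (1 + u) / u)"

lemma tendsto_ln_quotient: "(ln_quotient \<longlongrightarrow> 1) (nhds 0)"
proof -
  have "((\<lambda>u. ln (1 + u)) has_field_derivative 1) (at (0::real))"
    by (auto intro!: derivative_eq_intros)
  then have "((\<lambda>u. ln (1 + u) / u) \<longlongrightarrow> (1::real)) (at 0)"
    unfolding DERIV_def by simp
  then have "(ln_quotient \<longlongrightarrow> 1) (at 0)"
    by (rule tendsto_cong[THEN iffD1, rotated])
       (auto simp: ln_quotient_def eventually_at_filter)
  then show ?thesis by (simp add: tendsto_nhds_iff ln_quotient_def)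
qed

context prob_space
begin

text \<open>Jensen's inequality for the exponential function, proved from its tangent at the mean.\<close>

lemma entropic_utility_le_expectation:
  assumes "g \<le> 0" "integrable M Z" "integrable M (\<lambda>\<omega>. exp (g * Z \<omega>))"
  shows "entropic_utility M g Z \<le> expectation Z"
proof (cases "g = 0")
  case True
  then show ?thesis by (simp add: entropic_utility_def)
next
  case False
  let ?e = "g * expectation Z"
  have "exp ?e * (1 + (g * Z \<omega> - ?e)) \<le> exp (g * Z \<omega>)" for \<omega>
    using mult_left_mono[OF exp_ge_add_one_self[of "g * Z \<omega> - ?e"], of "exp ?e"]
    by (simp add: exp_add[symmetric])
  then have "expectation (\<lambda>\<omega>. exp ?e * (1 + (g * Z \<omega> - ?e))) \<le> expectation (\<lambda>\<omega>. exp (g * Z \<omega>))"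
    by (intro integral_mono) (use assms in auto)
  moreover have "expectation (\<lambda>\<omega>. exp ?e * (1 + (g * Z \<omega> - ?e))) = exp ?e"
    using assms by (simp add: prob_space)
  ultimately have *: "exp ?e \<le> expectation (\<lambda>\<omega>. exp (g * Z \<omega>))" by simp
  then have "?e \<le> ln (expectation (\<lambda>\<omega>. exp (g * Z \<omega>)))"
    by (metis exp_gt_zero ln_exp ln_le_cancel_iff order_less_le_trans)
  with False assms(1) show ?thesis
    by (simp add: entropic_utility_def neg_divide_le_eq mult.commute)
qed

lemma entropic_utility_add_const:
  assumes "g \<le> 0" "integrable M (\<lambda>\<omega>. exp (g * Z \<omega>))" "integrable M Z"
  shows "entropic_utility M g (\<lambda>\<omega>. Z \<omega> + a) = entropic_utility M g Z + a"
proof (cases "g = 0")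
  case True
  with assms(3) show ?thesis by (simp add: entropic_utility_def prob_space)
next
  case False
  have "0 < expectation (\<lambda>\<omega>. exp (g * Z \<omega>))"
    by (rule expectation_greater) (use assms in auto)
  then have "ln (exp (g * a) * expectation (\<lambda>\<omega>. exp (g * Z \<omega>))) =
      g * a + ln (expectation (\<lambda>\<omega>. exp (g * Z \<omega>)))"
    by (simp add: ln_mult)
  moreover have "expectation (\<lambda>\<omega>. exp (g * (Z \<omega> + a))) =
      exp (g * a) * expectation (\<lambda>\<omega>. exp (g * Z \<omega>))"
    by (simp add: distrib_left exp_add mult.commute)
  ultimately show ?thesis using False
    by (simp add: entropic_utility_def add_divide_distrib)
qed

text \<open>With \<open>a n = E[(e\<^sup>g\<^sup>Z - 1)/g]\<close> for \<open>g = g n\<close> and \<open>Z = Z n\<close>, the entropic utility is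
  \<open>ln (1 + g a) / g\<close>, that is, \<open>a\<close> times a factor that tends to 1. The numbers \<open>a n\<close> converge by
  dominated convergence. Letting \<open>g n = 0\<close> occur makes the lemma cover continuity at \<open>\<gamma> = 0\<close> too.\<close>

lemma tendsto_entropic_utility:
  fixes g :: "nat \<Rightarrow> real" and Z :: "nat \<Rightarrow> 'a \<Rightarrow> real"
  assumes g: "\<And>n. g n \<in> {-1..0}" "g \<longlonglongrightarrow> 0"
    and meas: "\<And>n. Z n \<in> borel_measurable M"
    and D: "integrable M D"
    and bnd: "\<And>n \<omega>. \<omega> \<in> space M \<Longrightarrow> \<bar>Z n \<omega>\<bar> \<le> D \<omega> \<and> exp (- Z n \<omega>) \<le> D \<omega>"
    and lim: "\<And>\<omega>. \<omega> \<in> space M \<Longrightarrow> (\<lambda>n. Z n \<omega>) \<longlonglongrightarrow> Z' \<omega>"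
  shows "(\<lambda>n. entropic_utility M (g n) (Z n)) \<longlonglongrightarrow> expectation Z'"
proof -
  let ?q = "\<lambda>n \<omega>. Z n \<omega> * exp_quotient (g n * Z n \<omega>)"
  have [measurable]: "Z n \<in> borel_measurable M" for n by (rule meas)
  have [measurable]: "Z' \<in> borel_measurable M"
    by (rule borel_measurable_LIMSEQ_metric[OF meas lim])
  have [measurable]: "exp_quotient \<in> borel_measurable borel"
    unfolding exp_quotient_def by measurable
  have qlim: "(\<lambda>n. ?q n \<omega>) \<longlonglongrightarrow> Z' \<omega>" if "\<omega> \<in> space M" for \<omega>
  proof -
    have "(\<lambda>n. g n * Z n \<omega>) \<longlonglongrightarrow> 0 * Z' \<omega>" by (intro tendsto_mult g lim that)
    then have "(\<lambda>n. exp_quotient (g n * Z n \<omega>)) \<longlonglongrightarrow> 1"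
      by (intro filterlim_compose[OF tendsto_exp_quotient]) simp
    from tendsto_mult[OF lim[OF that] this] show ?thesis by simp
  qed
  have qbnd: "norm (?q n \<omega>) \<le> D \<omega> + 1" if "\<omega> \<in> space M" for n \<omega>
    using exp_quotient_bounds[of "g n" "Z n \<omega>"] bnd[OF that, of n] g(1)[of n]
    by (auto simp: abs_le_iff)
  have D1: "integrable M (\<lambda>\<omega>. D \<omega> + 1)" using D by simp
  have A: "(\<lambda>n. expectation (?q n)) \<longlonglongrightarrow> expectation Z'"
  proof (rule integral_dominated_convergence[OF _ _ D1])
    show "AE \<omega> in M. (\<lambda>n. ?q n \<omega>) \<longlonglongrightarrow> Z' \<omega>" using qlim by (rule AE_I2)
    show "AE \<omega> in M. norm (?q n \<omega>) \<le> D \<omega> + 1" for n using qbnd by (rule AE_I2)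
  qed measurable
  have int: "integrable M (?q n)" for n
  proof (rule Bochner_Integration.integrable_bound[OF D1])
    show "AE \<omega> in M. norm (?q n \<omega>) \<le> norm (D \<omega> + 1)"
      unfolding real_norm_def[of "_ + _"] by (intro AE_I2 order_trans[OF qbnd abs_ge_self])
  qed measurable
  have eq: "entropic_utility M (g n) (Z n) = expectation (?q n) * ln_quotient (g n * expectation (?q n))" for n
  proof (cases "g n = 0")
    case True
    then show ?thesis by (simp add: entropic_utility_def ln_quotient_def exp_quotient_def)
  next
    case False
    have exp_eq: "exp (g n * Z n \<omega>) = 1 + g n * ?q n \<omega>" for \<omega>
      using exp_quotient_mult[of "g n * Z n \<omega>"] by (simp only: mult.assoc)
    have "expectation (\<lambda>\<omega>. exp (g n * Z n \<omega>)) = expectation (\<lambda>\<omega>. 1 + g n * ?q n \<omega>)"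
      unfolding exp_eq ..
    also have "\<dots> = expectation (\<lambda>\<omega>. 1) + expectation (\<lambda>\<omega>. g n * ?q n \<omega>)"
      by (rule Bochner_Integration.integral_add) (use int in simp_all)
    also have "\<dots> = 1 + g n * expectation (?q n)" by (simp add: prob_space)
    finally have "expectation (\<lambda>\<omega>. exp (g n * Z n \<omega>)) = 1 + g n * expectation (?q n)" .
    then show ?thesis using False by (simp add: entropic_utility_def ln_quotient_def)
  qed
  have "(\<lambda>n. g n * expectation (?q n)) \<longlonglongrightarrow> 0 * expectation Z'" by (intro tendsto_mult g A)
  then have "(\<lambda>n. ln_quotient (g n * expectation (?q n))) \<longlonglongrightarrow> 1"
    by (intro filterlim_compose[OF tendsto_ln_quotient]) simp
  from tendsto_mult[OF A this] show ?thesis by (simp add: eq)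
qed

end



section \<open>Prices at an independent waiting time\<close>

lemma renorm_in_simplex:
  assumes "x \<in> prob_simplex" "\<And>i. 0 < y $ i"
  shows "0 < x \<bullet> y" "renorm x y \<in> prob_simplex"
proof -
  have nn: "0 \<le> (x * y) $ i" for i using simplexD(1)[OF assms(1), of i] assms(2)[of i] by simp
  have ip: "(x * y) \<bullet> 1 = x \<bullet> y" by (simp add: inner_one inner_vec_def)
  obtain i where i: "x $ i \<noteq> 0"
  proof -
    have "x \<noteq> 0" using simplexD(2)[OF assms(1)] by auto
    then show ?thesis using that by (auto simp: vec_eq_iff)
  qed
  then have "(x * y) $ i \<noteq> 0" using assms(2)[of i] by simp
  then have ne: "x * y \<noteq> 0" by (metis zero_index)
  show "0 < x \<bullet> y" "renorm x y \<in> prob_simplex"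
    using normalise_in_simplex[OF nn ne] by (simp_all add: ip renorm_def)
qed

locale priced_market = market M S \<eta>
  for M :: "'a measure" and S :: "real \<Rightarrow> 'a \<Rightarrow> real^'d" and \<eta> +
  assumes increments: "increments_cond M S"
begin

lemma ret_pos: "\<omega> \<in> space M \<Longrightarrow> 0 \<le> t \<Longrightarrow> 0 < ret S 0 t \<omega> $ i"
  by (simp add: ret_def price_pos)

lemma tendsto_ret:
  assumes \<omega>: "\<omega> \<in> space M" and t: "0 \<le> t"
  shows "((\<lambda>u. ret S 0 u \<omega>) \<longlongrightarrow> ret S 0 t \<omega>) (at_right t)"
proof (rule vec_tendstoI)
  fix i
  have "((\<lambda>u. ln_vec (S u \<omega>)) \<longlongrightarrow> ln_vec (S t \<omega>)) (at_right t)"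
    using increments \<omega> t by (simp add: increments_cond_def continuous_within)
  then have "((\<lambda>u. ln_vec (S u \<omega>) $ i) \<longlongrightarrow> ln_vec (S t \<omega>) $ i) (at_right t)"
    by (rule tendsto_vec_nth)
  then have "((\<lambda>u. exp (ln_vec (S u \<omega>) $ i) / S 0 \<omega> $ i) \<longlongrightarrow> exp (ln_vec (S t \<omega>) $ i) / S 0 \<omega> $ i) (at_right t)"
    using price_pos[of 0 \<omega> i] \<omega> by (intro tendsto_divide tendsto_exp tendsto_const) auto
  moreover have "exp (ln_vec (S u \<omega>) $ i) / S 0 \<omega> $ i = ret S 0 u \<omega> $ i" if "0 \<le> u" for u
    using price_pos[OF that \<omega>, of i] by (simp add: ln_vec_def ret_def)
  moreover have "eventually (\<lambda>u. 0 \<le> u) (at_right t)"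
    using eventually_at_right_less[of t] by eventually_elim (use t in simp)
  ultimately show "((\<lambda>u. ret S 0 u \<omega> $ i) \<longlongrightarrow> ret S 0 t \<omega> $ i) (at_right t)"
    using t by (auto elim!: Lim_transform_eventually eventually_mono)
qed

lemma wait_measurable [measurable]: "\<eta> 1 \<in> borel_measurable M"
  using waiting_indep by (auto simp: indep_vars_def)

lemma ret_measurable:
  assumes N: "S 0 \<in> borel_measurable N" "S t \<in> borel_measurable N"
  shows "ret S 0 t \<in> borel_measurable N"
  by (rule borel_measurable_vecI)
     (simp add: ret_def borel_measurable_divide borel_measurable_vec_component N)

text \<open>A return involves the prices at two times, so the independence of the waiting time from the
  \<open>\<sigma>\<close>-algebra generated by all prices is what applies.\<close>

lemma indep_wait_ret:
  assumes t: "0 \<le> t" and f: "f \<in> borel_measurable borel"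
  shows "indep_var borel (\<eta> 1) borel (\<lambda>\<omega>. f (ret S 0 t \<omega>))"
  unfolding indep_var_eq
proof (intro conjI)
  have "ret S 0 t \<in> borel_measurable M" using t by (intro ret_measurable price_measurable) auto
  then show "random_variable borel (\<lambda>\<omega>. f (ret S 0 t \<omega>))" by (rule measurable_compose[OF _ f])
  let ?G = "{S t -` A \<inter> space M | t A. t \<ge> 0 \<and> A \<in> sets borel}"
  define N where "N = sigma (space M) ?G"
  have N: "space N = space M" "sets N = sigma_sets (space M) ?G" 
    unfolding N_def by (rule space_measure_of, blast, rule sets_measure_of, blast)
  have "S u \<in> borel_measurable N" if "0 \<le> u" for u
  proof (rule measurableI)
    fix A :: "(real^'d) set" assume "A \<in> sets borel"
    with that show "S u -` A \<inter> space N \<in> sets N" unfolding N by blast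
  qed simp
  then have "ret S 0 t \<in> borel_measurable N" using t by (intro ret_measurable) auto
  then have fN: "(\<lambda>\<omega>. f (ret S 0 t \<omega>)) \<in> borel_measurable N" by (rule measurable_compose[OF _ f])
  have "sigma_sets (space M) {(\<lambda>\<omega>. f (ret S 0 t \<omega>)) -` A \<inter> space M |A. A \<in> sets borel}
      \<subseteq> sigma_sets (space M) ?G"
    using measurable_sets[OF fN] by (intro sigma_sets_mono) (auto simp: N)
  moreover have "sigma_sets (space M) {\<eta> 1 -` A \<inter> space M |A. A \<in> sets borel}
      \<subseteq> sigma_sets (space M) {\<eta> i -` A \<inter> space M | i A. i \<ge> 1 \<and> A \<in> sets borel}"
    by (intro sigma_sets_mono') blast
  ultimately show "indep_set (sigma_sets (space M) {\<eta> 1 -` A \<inter> space M |A. A \<in> sets borel})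
      (sigma_sets (space M) {(\<lambda>\<omega>. f (ret S 0 t \<omega>)) -` A \<inter> space M |A. A \<in> sets borel})"
    using waiting_indep_price unfolding indep_set_def
    by (elim indep_sets_mono_sets) (auto split: bool.split)
qed (rule wait_measurable)

text \<open>The waiting time is rounded up, strictly, to the grid of mesh \<open>1 / (n + 1)\<close>. The rounded time
  exceeds \<open>\<eta> 1\<close>, so that right-continuity of the prices applies as the mesh shrinks, and it takes
  countably many values, so that independence can be used value by value.\<close>

definition tick :: "nat \<Rightarrow> 'a \<Rightarrow> nat" where
  "tick n \<omega> = nat \<lfloor>real (Suc n) * \<eta> 1 \<omega>\<rfloor> + 1"

definition grid_time :: "nat \<Rightarrow> 'a \<Rightarrow> real" where
  "grid_time n \<omega> = real (tick n \<omega>) / real (Suc n)"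

lemma tick_measurable [measurable]: "tick n \<in> measurable M (count_space UNIV)"
  unfolding tick_def by measurable

lemma grid_time_at_right:
  assumes "\<omega> \<in> space M"
  shows "filterlim (\<lambda>n. grid_time n \<omega>) (at_right (\<eta> 1 \<omega>)) sequentially"
proof -
  have \<eta>: "0 < \<eta> 1 \<omega>" using waiting_pos assms by simp
  have "real (Suc n) * \<eta> 1 \<omega> < real (tick n \<omega>) \<and> real (tick n \<omega>) \<le> real (Suc n) * \<eta> 1 \<omega> + 1" for n
  proof -
    have "0 \<le> \<lfloor>real (Suc n) * \<eta> 1 \<omega>\<rfloor>" using \<eta> by simp
    then have "real (tick n \<omega>) = of_int \<lfloor>real (Suc n) * \<eta> 1 \<omega>\<rfloor> + 1" unfolding tick_def by simp
    then show ?thesis by linarith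
  qed
  note bounds = this
  have b: "\<eta> 1 \<omega> < grid_time n \<omega>" "grid_time n \<omega> \<le> \<eta> 1 \<omega> + 1 / real (Suc n)" for n
  proof -
    have N: "0 < real (Suc n)" by simp
    show "\<eta> 1 \<omega> < grid_time n \<omega>"
      unfolding grid_time_def using bounds[of n] by (simp only: pos_less_divide_eq[OF N] mult.commute)
    have "grid_time n \<omega> \<le> (real (Suc n) * \<eta> 1 \<omega> + 1) / real (Suc n)"
      unfolding grid_time_def using bounds[of n] N by (intro divide_right_mono) auto
    then show "grid_time n \<omega> \<le> \<eta> 1 \<omega> + 1 / real (Suc n)"
      using N by (simp only: add_divide_distrib) simp
  qed
  have "(\<lambda>n. \<eta> 1 \<omega> + 1 / real (Suc n)) \<longlonglongrightarrow> \<eta> 1 \<omega> + 0"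
    using LIMSEQ_Suc[OF lim_1_over_n] by (intro tendsto_intros) simp
  then have up: "(\<lambda>n. \<eta> 1 \<omega> + 1 / real (Suc n)) \<longlonglongrightarrow> \<eta> 1 \<omega>" by (simp only: add_0_right)
  have lo: "\<forall>\<^sub>F n in sequentially. \<eta> 1 \<omega> \<le> grid_time n \<omega>"
    by (rule always_eventually, rule allI, rule less_imp_le, rule b(1))
  have hi: "\<forall>\<^sub>F n in sequentially. grid_time n \<omega> \<le> \<eta> 1 \<omega> + 1 / real (Suc n)"
    by (rule always_eventually, rule allI, rule b(2))
  have "(\<lambda>n. grid_time n \<omega>) \<longlonglongrightarrow> \<eta> 1 \<omega>"
    by (rule tendsto_sandwich[OF lo hi tendsto_const up])
  moreover have "grid_time n \<omega> \<noteq> \<eta> 1 \<omega>" for n using b(1)[of n] by (rule less_imp_neq[symmetric])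
  ultimately show ?thesis unfolding filterlim_at using b(1) by simp
qed

lemma grid_time_nonneg: "0 \<le> grid_time n \<omega>"
  by (simp add: grid_time_def)

lemma wait_ret_measurable [measurable]: "wait_ret S \<eta> \<in> borel_measurable M"
proof (rule borel_measurable_LIMSEQ_metric)
  show "(\<lambda>\<omega>. ret S 0 (grid_time n \<omega>) \<omega>) \<in> borel_measurable M" for n
    unfolding grid_time_def
    by (rule measurable_compose_countable[where f = "\<lambda>k. ret S 0 (real k / real (Suc n))" and g = "tick n"])
       (auto intro!: ret_measurable price_measurable)
  show "(\<lambda>n. ret S 0 (grid_time n \<omega>) \<omega>) \<longlonglongrightarrow> wait_ret S \<eta> \<omega>" if "\<omega> \<in> space M" for \<omega>
    unfolding wait_ret_def
    by (rule filterlim_compose[OF tendsto_ret grid_time_at_right])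
       (use that waiting_pos[of 1 \<omega>] in auto)
qed

lemma wait_ret_pos: "\<omega> \<in> space M \<Longrightarrow> 0 < wait_ret S \<eta> \<omega> $ i"
  unfolding wait_ret_def using waiting_pos[of 1 \<omega>] by (intro ret_pos) auto

text \<open>Split the expectation over the countably many values of the grid time; on each piece the indicator is
  a function of \<open>\<eta> 1\<close> and therefore independent of the process at that fixed time.\<close>

lemma nn_integral_at_grid_time:
  fixes Y :: "real \<Rightarrow> 'a \<Rightarrow> real"
  assumes indep: "\<And>t. 0 \<le> t \<Longrightarrow> indep_var borel (\<eta> 1) borel (Y t)"
    and range: "\<And>t \<omega>. 0 \<le> t \<Longrightarrow> \<omega> \<in> space M \<Longrightarrow> Y t \<omega> \<in> {0..B}"
  shows "(\<integral>\<^sup>+\<omega>. ennreal (Y (grid_time n \<omega>) \<omega>) \<partial>M) =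
    (\<integral>\<^sup>+\<omega>. ennreal (expectation (Y (grid_time n \<omega>))) \<partial>M)"
proof -
  define \<tau> where "\<tau> k = real k / real (Suc n)" for k
  have \<tau>: "0 \<le> \<tau> k" for k by (simp add: \<tau>_def)
  have grid: "grid_time n \<omega> = \<tau> (tick n \<omega>)" for \<omega> by (simp add: grid_time_def \<tau>_def)
  define I where "I k \<omega> = (if tick n \<omega> = k then 1 else 0 :: real)" for k \<omega>
  have meas[measurable]: "Y (\<tau> k) \<in> borel_measurable M" for k
    using indep[OF \<tau>] by (simp add: indep_var_eq)
  have [measurable]: "I k \<in> borel_measurable M" for k unfolding I_def by measurable
  have split: "ennreal (F (tick n \<omega>)) = (\<Sum>k. ennreal (I k \<omega> * F k))" for F :: "nat \<Rightarrow> real" and \<omega>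
  proof -
    have "(\<lambda>k. if k = tick n \<omega> then ennreal (F k) else 0) sums ennreal (F (tick n \<omega>))"
      by (rule sums_single)
    then have "(\<lambda>k. ennreal (I k \<omega> * F k)) sums ennreal (F (tick n \<omega>))"
      by (rule sums_cong[THEN iffD1, rotated]) (auto simp: I_def)
    then show ?thesis by (rule sums_unique)
  qed
  have Yint: "integrable M (Y (\<tau> k))" for k
    by (rule integrable_const_bound[of _ B]) (use range[OF \<tau>, of _ k] meas[of k] in \<open>auto intro!: AE_I2\<close>)
  have Iint: "integrable M (I k)" for k
    by (rule integrable_const_bound[of _ 1]) (auto simp: I_def)
  have "(\<integral>\<^sup>+\<omega>. ennreal (I k \<omega> * Y (\<tau> k) \<omega>) \<partial>M) =
      (\<integral>\<^sup>+\<omega>. ennreal (I k \<omega> * expectation (Y (\<tau> k))) \<partial>M)" for k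
  proof -
    have "I k = (\<lambda>t. if nat \<lfloor>real (Suc n) * t\<rfloor> + 1 = k then 1 else 0) \<circ> \<eta> 1"
      by (auto simp: I_def tick_def)
    moreover have "indep_var borel ((\<lambda>t. if nat \<lfloor>real (Suc n) * t\<rfloor> + 1 = k then 1 else 0 :: real) \<circ> \<eta> 1)
        borel (id \<circ> Y (\<tau> k))"
      by (rule indep_var_compose[OF indep[OF \<tau>]]) auto
    ultimately have iv: "indep_var borel (I k) borel (Y (\<tau> k))" by simp
    have "(\<integral>\<^sup>+\<omega>. ennreal (I k \<omega> * Y (\<tau> k) \<omega>) \<partial>M) = ennreal (expectation (\<lambda>\<omega>. I k \<omega> * Y (\<tau> k) \<omega>))"
      by (rule nn_integral_eq_integral[OF indep_var_integrable[OF iv Iint Yint]])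
         (use range[OF \<tau>, of _ k] meas[of k] in \<open>auto simp: I_def intro!: AE_I2\<close>)
    also have "expectation (\<lambda>\<omega>. I k \<omega> * Y (\<tau> k) \<omega>) = expectation (\<lambda>\<omega>. I k \<omega> * expectation (Y (\<tau> k)))"
      by (simp add: indep_var_lebesgue_integral[OF iv Iint Yint])
    also have "ennreal \<dots> = (\<integral>\<^sup>+\<omega>. ennreal (I k \<omega> * expectation (Y (\<tau> k))) \<partial>M)"
    proof (rule nn_integral_eq_integral[symmetric])
      have "0 \<le> expectation (Y (\<tau> k))"
        using range[OF \<tau>] by (intro integral_nonneg_AE AE_I2) auto
      then show "AE \<omega> in M. 0 \<le> I k \<omega> * expectation (Y (\<tau> k))" by (auto simp: I_def)
    qed (use Iint[of k] in simp)
    finally show ?thesis .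
  qed
  then have "(\<Sum>k. \<integral>\<^sup>+\<omega>. ennreal (I k \<omega> * Y (\<tau> k) \<omega>) \<partial>M) =
      (\<Sum>k. \<integral>\<^sup>+\<omega>. ennreal (I k \<omega> * expectation (Y (\<tau> k))) \<partial>M)" by simp
  then have "(\<integral>\<^sup>+\<omega>. (\<Sum>k. ennreal (I k \<omega> * Y (\<tau> k) \<omega>)) \<partial>M) =
      (\<integral>\<^sup>+\<omega>. (\<Sum>k. ennreal (I k \<omega> * expectation (Y (\<tau> k)))) \<partial>M)"
    by (subst (1 2) nn_integral_suminf) auto
  then show ?thesis
    unfolding split[symmetric, where F = "\<lambda>k. expectation (Y (\<tau> k))"] grid
    by (simp only: split[symmetric, where F = "\<lambda>k. Y (\<tau> k) _"])
qed

text \<open>Freezing the waiting time: a bounded right-continuous process whose values are independent of \<open>\<eta> 1\<close> has at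
  time \<open>\<eta> 1\<close> the mean that results from evaluating its mean function at \<open>\<eta> 1\<close>. On the grid this
  is a countable sum; dominated convergence passes to the limit for the process and its mean function.\<close>

lemma expectation_at_waiting_time:
  fixes Y :: "real \<Rightarrow> 'a \<Rightarrow> real"
  assumes indep: "\<And>t. 0 \<le> t \<Longrightarrow> indep_var borel (\<eta> 1) borel (Y t)"
    and range: "\<And>t \<omega>. 0 \<le> t \<Longrightarrow> \<omega> \<in> space M \<Longrightarrow> Y t \<omega> \<in> {0..B}"
    and right: "\<And>t \<omega>. 0 \<le> t \<Longrightarrow> \<omega> \<in> space M \<Longrightarrow> ((\<lambda>u. Y u \<omega>) \<longlongrightarrow> Y t \<omega>) (at_right t)"
  shows "expectation (\<lambda>\<omega>. Y (\<eta> 1 \<omega>) \<omega>) = expectation (\<lambda>\<omega>. expectation (Y (\<eta> 1 \<omega>)))"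
    and "integrable M (\<lambda>\<omega>. expectation (Y (\<eta> 1 \<omega>)))"
proof -
  let ?t = "\<lambda>n k. real k / real (Suc n)"
  have Ymeas: "Y t \<in> borel_measurable M" if "0 \<le> t" for t
    using indep[OF that] by (simp add: indep_var_eq)
  have Yint: "integrable M (Y t)" if "0 \<le> t" for t
    by (rule integrable_const_bound[of _ B]) (use range[OF that] Ymeas[OF that] in \<open>auto intro!: AE_I2\<close>)
  have Erange: "0 \<le> expectation (Y t) \<and> expectation (Y t) \<le> B" if "0 \<le> t" for t
    using integral_mono[OF Yint[OF that], of "\<lambda>_. B"] range[OF that]
    by (auto simp: prob_space intro!: integral_nonneg_AE AE_I2)
  have \<eta>0: "0 \<le> \<eta> 1 \<omega>" if "\<omega> \<in> space M" for \<omega> using waiting_pos[of 1 \<omega>] that by simp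
  have m1: "(\<lambda>\<omega>. Y (grid_time n \<omega>) \<omega>) \<in> borel_measurable M" for n
    unfolding grid_time_def
    by (rule measurable_compose_countable[where f = "\<lambda>k. Y (?t n k)" and g = "tick n"])
       (auto intro!: Ymeas)
  have m2: "(\<lambda>\<omega>. expectation (Y (grid_time n \<omega>))) \<in> borel_measurable M" for n
    unfolding grid_time_def
    by (rule measurable_compose[OF tick_measurable, where g = "\<lambda>k. expectation (Y (?t n k))"]) simp
  have l1: "(\<lambda>n. Y (grid_time n \<omega>) \<omega>) \<longlonglongrightarrow> Y (\<eta> 1 \<omega>) \<omega>" if "\<omega> \<in> space M" for \<omega>
    by (rule filterlim_compose[OF right grid_time_at_right]) (use that \<eta>0 in auto)
  have B: "integrable M (\<lambda>_. B)" by simp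
  have l2: "(\<lambda>n. expectation (Y (grid_time n \<omega>))) \<longlonglongrightarrow> expectation (Y (\<eta> 1 \<omega>))"
    if \<omega>: "\<omega> \<in> space M" for \<omega>
  proof (rule integral_dominated_convergence[OF _ _ B])
    show "AE \<omega>' in M. (\<lambda>n. Y (grid_time n \<omega>) \<omega>') \<longlonglongrightarrow> Y (\<eta> 1 \<omega>) \<omega>'"
      by (rule AE_I2, rule filterlim_compose[OF right grid_time_at_right]) (use \<omega> \<eta>0 in auto)
    show "AE \<omega>' in M. norm (Y (grid_time n \<omega>) \<omega>') \<le> B" for n
      using range[OF grid_time_nonneg] by (intro AE_I2) auto
    show "Y (\<eta> 1 \<omega>) \<in> borel_measurable M" "Y (grid_time n \<omega>) \<in> borel_measurable M" for n
      by (intro Ymeas \<eta>0[OF \<omega>] grid_time_nonneg)+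
  qed
  have A1: "(\<lambda>n. expectation (\<lambda>\<omega>. Y (grid_time n \<omega>) \<omega>)) \<longlonglongrightarrow> expectation (\<lambda>\<omega>. Y (\<eta> 1 \<omega>) \<omega>)"
  proof (rule integral_dominated_convergence[OF _ m1 B])
    show "(\<lambda>\<omega>. Y (\<eta> 1 \<omega>) \<omega>) \<in> borel_measurable M"
      by (rule borel_measurable_LIMSEQ_metric[OF m1 l1])
    show "AE \<omega> in M. norm (Y (grid_time n \<omega>) \<omega>) \<le> B" for n
      using range[OF grid_time_nonneg] by (intro AE_I2) auto
  qed (use l1 in \<open>rule AE_I2\<close>)
  have m3: "(\<lambda>\<omega>. expectation (Y (\<eta> 1 \<omega>))) \<in> borel_measurable M"
    by (rule borel_measurable_LIMSEQ_metric[OF m2 l2])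
  have A2: "(\<lambda>n. expectation (\<lambda>\<omega>. expectation (Y (grid_time n \<omega>)))) \<longlonglongrightarrow>
      expectation (\<lambda>\<omega>. expectation (Y (\<eta> 1 \<omega>)))"
  proof (rule integral_dominated_convergence[OF m3 m2 B])
    show "AE \<omega> in M. norm (expectation (Y (grid_time n \<omega>))) \<le> B" for n
      using Erange[OF grid_time_nonneg] by (intro AE_I2) auto
  qed (use l2 in \<open>rule AE_I2\<close>)
  show "integrable M (\<lambda>\<omega>. expectation (Y (\<eta> 1 \<omega>)))"
    by (rule integrable_const_bound[of _ B]) (use Erange \<eta>0 m3 in \<open>auto intro!: AE_I2\<close>)
  have "expectation (\<lambda>\<omega>. Y (grid_time n \<omega>) \<omega>) = expectation (\<lambda>\<omega>. expectation (Y (grid_time n \<omega>)))" for n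
  proof -
    have "(\<integral>\<^sup>+\<omega>. ennreal (Y (grid_time n \<omega>) \<omega>) \<partial>M) =
        (\<integral>\<^sup>+\<omega>. ennreal (expectation (Y (grid_time n \<omega>))) \<partial>M)"
      using indep range by (rule nn_integral_at_grid_time)
    moreover have "AE \<omega> in M. 0 \<le> Y (grid_time n \<omega>) \<omega>"
      using range[OF grid_time_nonneg] by (intro AE_I2) auto
    moreover have "AE \<omega> in M. 0 \<le> expectation (Y (grid_time n \<omega>))"
      using Erange[OF grid_time_nonneg] by (intro AE_I2) auto
    ultimately show ?thesis
      using m1[of n] m2[of n] by (simp add: integral_eq_nn_integral)
  qed
  with A1 have "(\<lambda>n. expectation (\<lambda>\<omega>. expectation (Y (grid_time n \<omega>)))) \<longlonglongrightarrow> expectation (\<lambda>\<omega>. Y (\<eta> 1 \<omega>) \<omega>)"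
    by simp
  from LIMSEQ_unique[OF this A2]
  show "expectation (\<lambda>\<omega>. Y (\<eta> 1 \<omega>) \<omega>) = expectation (\<lambda>\<omega>. expectation (Y (\<eta> 1 \<omega>)))" .
qed

text \<open>The event that \<open>g\<close> is positive is the event that the renormalised portfolio lies in an open set, so
  a function that is positive somewhere has a positive mean at every deterministic time, and therefore
  at the waiting time.\<close>

lemma full_support_at_waiting_time:
  assumes full: "full_support_cond M S"
    and \<pi>: "\<pi> \<in> open_prob_simplex"
    and g: "continuous_on prob_simplex g" "\<And>y. y \<in> prob_simplex \<Longrightarrow> 0 \<le> (g y :: real)"
    and AE: "AE \<omega> in M. g (renorm \<pi> (wait_ret S \<eta> \<omega>)) = 0"
    and x: "x \<in> prob_simplex"
  shows "g x = 0"
proof (rule ccontr)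
  assume "g x \<noteq> 0"
  have \<pi>': "\<pi> \<in> prob_simplex" using \<pi> by (simp add: open_prob_simplex_def)
  obtain B where B: "\<And>y. y \<in> prob_simplex \<Longrightarrow> g y \<le> B"
    using continuous_attains_sup[OF compact_prob_simplex prob_simplex_nonempty g(1)] by blast
  define Y where "Y t \<omega> = g (renorm \<pi> (ret S 0 t \<omega>))" for t \<omega>
  have in_simplex: "renorm \<pi> (ret S 0 t \<omega>) \<in> prob_simplex" if "0 \<le> t" "\<omega> \<in> space M" for t \<omega>
    using renorm_in_simplex(2)[OF \<pi>' ret_pos[OF that(2,1)]] .
  have range: "Y t \<omega> \<in> {0..B}" if "0 \<le> t" "\<omega> \<in> space M" for t \<omega>
    using in_simplex[OF that] g(2) B by (auto simp: Y_def)
  have indep: "indep_var borel (\<eta> 1) borel (Y t)" if "0 \<le> t" for t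
  proof -
    define f where "f y = (if renorm \<pi> y \<in> prob_simplex then g (renorm \<pi> y) else 0)" for y
    have rm: "renorm \<pi> \<in> borel_measurable borel"
      unfolding renorm_def
      by (intro borel_measurable_scaleR borel_measurable_vec_mult) measurable
    have "(\<lambda>x. indicator prob_simplex x *\<^sub>R g x) \<in> borel_measurable borel"
      by (rule borel_measurable_continuous_on_indicator[OF _ g(1)])
         (simp add: borel_compact compact_prob_simplex)
    from measurable_compose[OF rm this] have "f \<in> borel_measurable borel"
      by (rule measurable_cong[THEN iffD1, rotated]) (simp add: f_def)
    from indep_wait_ret[OF that this]
    have "indep_var borel (\<eta> 1) borel (\<lambda>\<omega>. f (ret S 0 t \<omega>))" .
    moreover have "f (ret S 0 t \<omega>) = Y t \<omega>" if "\<omega> \<in> space M" for \<omega>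
      using in_simplex[OF \<open>0 \<le> t\<close> that] by (simp add: f_def Y_def)
    then have "(\<lambda>\<omega>. f (ret S 0 t \<omega>)) -` A \<inter> space M = Y t -` A \<inter> space M" for A by auto
    moreover have "random_variable borel (\<lambda>\<omega>. f (ret S 0 t \<omega>)) = random_variable borel (Y t)"
      by (rule measurable_cong) fact
    ultimately show ?thesis unfolding indep_var_eq by simp
  qed
  have right: "((\<lambda>u. Y u \<omega>) \<longlongrightarrow> Y t \<omega>) (at_right t)" if "0 \<le> t" "\<omega> \<in> space M" for t \<omega>
  proof -
    have "((\<lambda>u. renorm \<pi> (ret S 0 u \<omega>)) \<longlongrightarrow> renorm \<pi> (ret S 0 t \<omega>)) (at_right t)"
      unfolding renorm_def
      using renorm_in_simplex(1)[OF \<pi>' ret_pos[OF that(2,1)]]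
      by (intro tendsto_intros tendsto_vec_mult tendsto_ret that) auto
    moreover have "eventually (\<lambda>u. renorm \<pi> (ret S 0 u \<omega>) \<in> prob_simplex) (at_right t)"
      using eventually_at_right_less[of t] by eventually_elim (use in_simplex that in auto)
    ultimately show ?thesis
      unfolding Y_def by (intro continuous_on_tendsto_compose[OF g(1)] in_simplex that)
  qed
  have freeze: "expectation (\<lambda>\<omega>. Y (\<eta> 1 \<omega>) \<omega>) = expectation (\<lambda>\<omega>. expectation (Y (\<eta> 1 \<omega>)))"
    "integrable M (\<lambda>\<omega>. expectation (Y (\<eta> 1 \<omega>)))"
    using expectation_at_waiting_time[of Y B] indep range right by blast+
  have pos: "0 < expectation (Y t)" if t: "0 < t" for t
  proof -
    have Ym: "Y t \<in> borel_measurable M" using indep[of t] t by (simp add: indep_var_eq)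
    have "integrable M (Y t)"
      by (rule integrable_const_bound[of _ B]) (use range[of t] t Ym in \<open>auto intro!: AE_I2\<close>)
    moreover have nn: "AE \<omega> in M. 0 \<le> Y t \<omega>" using range[of t] t by (intro AE_I2) auto
    moreover have "\<not> (AE \<omega> in M. Y t \<omega> = 0)"
    proof
      assume *: "AE \<omega> in M. Y t \<omega> = 0"
      let ?C = "prob_simplex \<inter> g -` {0<..}"
      have "openin (top_of_set prob_simplex) ?C"
        using g(1) by (rule continuous_openin_preimage_gen) simp
      moreover have "?C \<noteq> {}" using x g(2)[OF x] \<open>g x \<noteq> 0\<close> by force
      ultimately have "0 < prob {\<omega> \<in> space M. renorm \<pi> (ret S 0 t \<omega>) \<in> ?C}"
        using full \<pi> t unfolding full_support_cond_def by blast
      moreover have "{\<omega> \<in> space M. renorm \<pi> (ret S 0 t \<omega>) \<in> ?C} = {\<omega> \<in> space M. 0 < Y t \<omega>}"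
        using in_simplex[of t] t by (auto simp: Y_def)
      moreover have "prob {\<omega> \<in> space M. 0 < Y t \<omega>} = 0"
        by (subst prob_Collect_eq_0) (use * Ym in auto)
      ultimately show False by simp
    qed
    ultimately show ?thesis
      using integral_nonneg_eq_0_iff_AE[of M "Y t"] integral_nonneg_AE[OF nn] by fastforce
  qed
  have "expectation (\<lambda>\<omega>. Y (\<eta> 1 \<omega>) \<omega>) = 0"
    by (rule integral_eq_zero_AE) (use AE in \<open>simp add: Y_def wait_ret_def\<close>)
  moreover have "0 < expectation (\<lambda>\<omega>. expectation (Y (\<eta> 1 \<omega>)))"
    by (rule expectation_greater[OF freeze(2)]) (use pos waiting_pos in \<open>auto intro!: AE_I2\<close>)
  ultimately show False using freeze(1) by simp
qed

end



section \<open>The Bellman equation\<close>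

lemma tendsto_uniform_limit_moving_point:
  fixes v :: "nat \<Rightarrow> 'b::metric_space \<Rightarrow> real"
  assumes lim: "uniform_limit A v v' sequentially" and v': "continuous_on A v'"
    and z: "\<And>n. z n \<in> A" "z \<longlonglongrightarrow> z'" "z' \<in> A"
  shows "(\<lambda>n. v n (z n)) \<longlonglongrightarrow> v' z'"
proof -
  have 1: "(\<lambda>n. v' (z n)) \<longlonglongrightarrow> v' z'"
    by (rule continuous_on_tendsto_compose[OF v' z(2,3)]) (simp add: z(1))
  have "(\<lambda>n. v n (z n) - v' (z n)) \<longlonglongrightarrow> 0"
  proof (rule tendstoI)
    fix e :: real assume "0 < e"
    from uniform_limitD[OF lim this]
    show "\<forall>\<^sub>F n in sequentially. dist (v n (z n) - v' (z n)) 0 < e"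
      by eventually_elim (use z(1) in \<open>auto simp: dist_real_def\<close>)
  qed
  from tendsto_add[OF this 1] show ?thesis by simp
qed

locale rebalancing = priced_market M S \<eta> + transaction_costs c h
  for M :: "'a measure" and S :: "real \<Rightarrow> 'a \<Rightarrow> real^'d" and \<eta> and c h :: "real^'d" +
  assumes square: "square_integrability_cond M S \<eta>"
begin

abbreviation R :: "'a \<Rightarrow> real^'d" where "R \<equiv> wait_ret S \<eta>"

definition worst :: "'a \<Rightarrow> real" where
  "worst \<omega> = (MIN i. ln_vec (R \<omega>) $ i)"

definition best :: "'a \<Rightarrow> real" where
  "best \<omega> = (MAX i. ln_vec (R \<omega>) $ i)"

definition envelope :: "'a \<Rightarrow> real" where
  "envelope \<omega> = \<bar>best \<omega>\<bar> + exp (- worst \<omega>)"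

lemma integrable_exp_worst: "g \<le> 0 \<Longrightarrow> integrable M (\<lambda>\<omega>. exp (g * worst \<omega>))"
  using square by (cases "g = 0") (auto simp: square_integrability_cond_def worst_def)

lemma best_measurable [measurable]: "best \<in> borel_measurable M"
  unfolding best_def
proof (rule borel_measurable_Max)
  show "(\<lambda>\<omega>. ln_vec (R \<omega>) $ i) \<in> borel_measurable M" for i
    using borel_measurable_ln[OF borel_measurable_vec_component[OF wait_ret_measurable, of i]]
    by (simp add: ln_vec_def)
qed simp

lemma integrable_envelope: "integrable M envelope"
proof -
  have "integrable M (\<lambda>\<omega>. (best \<omega>)\<^sup>2)"
    using square by (simp add: square_integrability_cond_def best_def)
  then have "integrable M best" by (rule square_integrable_imp_integrable[OF best_measurable])
  then show ?thesis
    unfolding envelope_def using integrable_exp_worst[of "-1"] by simp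
qed

lemma ln_return_bounds:
  assumes "y \<in> prob_simplex" "\<omega> \<in> space M"
  shows "worst \<omega> \<le> ln (y \<bullet> R \<omega>)" "ln (y \<bullet> R \<omega>) \<le> best \<omega>"
proof -
  have pos: "0 < R \<omega> $ i" for i by (rule wait_ret_pos[OF assms(2)])
  have l: "worst \<omega> \<le> ln_vec (R \<omega>) $ i" "ln_vec (R \<omega>) $ i \<le> best \<omega>" for i
    unfolding worst_def best_def by (auto intro!: Min_le Max_ge)
  have b: "exp (worst \<omega>) \<le> R \<omega> $ i" "R \<omega> $ i \<le> exp (best \<omega>)" for i
    using l[of i] pos[of i] ln_ge_iff[OF pos[of i], of "worst \<omega>"]
      exp_le_cancel_iff[of "ln (R \<omega> $ i)" "best \<omega>"]
    by (simp_all add: ln_vec_def del: exp_le_cancel_iff)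
  have 1: "(\<Sum>i\<in>UNIV. y $ i * a) = a" for a
    using simplexD(2)[OF assms(1)] by (simp add: sum_distrib_right[symmetric] inner_one)
  have "(\<Sum>i\<in>UNIV. y $ i * exp (worst \<omega>)) \<le> y \<bullet> R \<omega>" "y \<bullet> R \<omega> \<le> (\<Sum>i\<in>UNIV. y $ i * exp (best \<omega>))"
    unfolding inner_vec_def inner_real_def
    using b simplexD(1)[OF assms(1)] by (auto intro!: sum_mono mult_left_mono)
  then have "exp (worst \<omega>) \<le> y \<bullet> R \<omega>" "y \<bullet> R \<omega> \<le> exp (best \<omega>)" by (simp_all add: 1)
  moreover have "0 < y \<bullet> R \<omega>" by (rule renorm_in_simplex(1)[OF assms(1) pos])
  ultimately show "worst \<omega> \<le> ln (y \<bullet> R \<omega>)" "ln (y \<bullet> R \<omega>) \<le> best \<omega>"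
    using exp_le_cancel_iff[of "ln (y \<bullet> R \<omega>)" "best \<omega>"]
    by (simp_all add: ln_ge_iff del: exp_le_cancel_iff)
qed

lemma renorm_R_in_simplex:
  "y \<in> prob_simplex \<Longrightarrow> \<omega> \<in> space M \<Longrightarrow> renorm y (R \<omega>) \<in> prob_simplex"
  by (rule renorm_in_simplex(2)) (auto intro: wait_ret_pos)

lemma return_pos: "y \<in> prob_simplex \<Longrightarrow> \<omega> \<in> space M \<Longrightarrow> 0 < y \<bullet> R \<omega>"
  by (rule renorm_in_simplex(1)) (auto intro: wait_ret_pos)

definition payoff :: "(real^'d \<Rightarrow> real) \<Rightarrow> real^'d \<Rightarrow> 'a \<Rightarrow> real" where
  "payoff v y \<omega> = ln (y \<bullet> R \<omega>) + v (renorm y (R \<omega>))"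

lemma payoff_bounds:
  assumes "\<And>x. x \<in> prob_simplex \<Longrightarrow> \<bar>v x\<bar> \<le> B" "y \<in> prob_simplex" "\<omega> \<in> space M"
  shows "worst \<omega> - B \<le> payoff v y \<omega>" "\<bar>payoff v y \<omega>\<bar> \<le> envelope \<omega> + B"
proof -
  note l = ln_return_bounds[OF assms(2,3)]
  have v: "\<bar>v (renorm y (R \<omega>))\<bar> \<le> B" using assms renorm_R_in_simplex by blast
  show "worst \<omega> - B \<le> payoff v y \<omega>" unfolding payoff_def using l v by linarith
  have "- worst \<omega> \<le> exp (- worst \<omega>)" using exp_ge_add_one_self[of "- worst \<omega>"] by linarith
  moreover have "0 < exp (- worst \<omega>)" by simp
  ultimately have "\<bar>ln (y \<bullet> R \<omega>)\<bar> \<le> envelope \<omega>" unfolding envelope_def using l by linarith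
  then show "\<bar>payoff v y \<omega>\<bar> \<le> envelope \<omega> + B" unfolding payoff_def using v by linarith
qed

lemma payoff_measurable:
  assumes "continuous_on prob_simplex v" "y \<in> prob_simplex"
  shows "payoff v y \<in> borel_measurable M"
proof -
  have "(\<lambda>\<omega>. renorm y (R \<omega>)) \<in> borel_measurable M"
    unfolding renorm_def by (intro borel_measurable_scaleR borel_measurable_vec_mult) measurable
  then have "(\<lambda>\<omega>. v (renorm y (R \<omega>))) \<in> borel_measurable M"
    by (rule borel_measurable_continuous_on_simplex[OF assms(1)]) (rule renorm_R_in_simplex[OF assms(2)])
  then show ?thesis unfolding payoff_def by measurable
qed

lemma continuous_on_simplex_bounded:
  fixes v :: "real^'d \<Rightarrow> real"
  assumes "continuous_on prob_simplex v"
  obtains B where "\<And>x. x \<in> prob_simplex \<Longrightarrow> \<bar>v x\<bar> \<le> B"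
proof -
  have "bounded (v ` prob_simplex)"
    by (intro compact_imp_bounded compact_continuous_image assms compact_prob_simplex)
  then show ?thesis using that by (auto simp: bounded_iff)
qed

text \<open>Since \<open>v\<close> is bounded and portfolio returns lie between the worst and the best single asset, the
  square integrability condition controls the payoff of every portfolio at once.\<close>

lemma integrable_payoff:
  assumes v: "continuous_on prob_simplex v" and y: "y \<in> prob_simplex"
  shows "integrable M (payoff v y)"
    and "g \<le> 0 \<Longrightarrow> integrable M (\<lambda>\<omega>. exp (g * payoff v y \<omega>))"
proof -
  obtain B where B: "\<And>x. x \<in> prob_simplex \<Longrightarrow> \<bar>v x\<bar> \<le> B"
    using continuous_on_simplex_bounded[OF v] by blast
  note [measurable] = payoff_measurable[OF v y]
  have i: "integrable M (\<lambda>\<omega>. envelope \<omega> + B)" using integrable_envelope by simp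
  show "integrable M (payoff v y)"
  proof (rule Bochner_Integration.integrable_bound[OF i])
    show "AE \<omega> in M. norm (payoff v y \<omega>) \<le> norm (envelope \<omega> + B)"
      unfolding real_norm_def by (intro AE_I2 order_trans[OF payoff_bounds(2)[OF B y] abs_ge_self])
  qed measurable
  assume g: "g \<le> 0"
  have i2: "integrable M (\<lambda>\<omega>. exp (- g * B) * exp (g * worst \<omega>))"
    using integrable_exp_worst[OF g] by simp
  show "integrable M (\<lambda>\<omega>. exp (g * payoff v y \<omega>))"
  proof (rule Bochner_Integration.integrable_bound[OF i2])
    have "exp (g * payoff v y \<omega>) \<le> exp (- g * B) * exp (g * worst \<omega>)" if "\<omega> \<in> space M" for \<omega>
      using mult_left_mono_neg[OF payoff_bounds(1)[OF B y that] g]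
      by (simp add: exp_add[symmetric] algebra_simps)
    then show "AE \<omega> in M. norm (exp (g * payoff v y \<omega>)) \<le> norm (exp (- g * B) * exp (g * worst \<omega>))"
      by (intro AE_I2) simp
  qed measurable
qed

text \<open>The right-hand side of the Bellman equation without the constant \<open>lam * E[\<eta> 1]\<close>, which does not
  affect maximisers and is better treated as a separate unknown.\<close>

definition J :: "real \<Rightarrow> (real^'d \<Rightarrow> real) \<Rightarrow> real^'d \<Rightarrow> real^'d \<Rightarrow> real" where
  "J g v \<pi> y = ln (shrinkage c h \<pi> y) + entropic_utility M g (payoff v y)"

lemma bellman_objective_eq:
  "bellman_objective M S \<eta> c h g v lam \<pi> y = J g v \<pi> y - lam * expectation (\<eta> 1)"
  by (simp add: bellman_objective_def J_def payoff_def[abs_def])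

lemma J_add_const:
  assumes "continuous_on prob_simplex v" "y \<in> prob_simplex" "g \<le> 0"
  shows "J g (\<lambda>x. v x + a) \<pi> y = J g v \<pi> y + a"
proof -
  have "payoff (\<lambda>x. v x + a) y = (\<lambda>\<omega>. payoff v y \<omega> + a)" by (auto simp: payoff_def)
  then show ?thesis
    using entropic_utility_add_const[OF assms(3) integrable_payoff(2)[OF assms(1,2,3)] integrable_payoff(1)[OF assms(1,2)]]
    by (simp add: J_def)
qed

lemma J_bounded:
  assumes v: "continuous_on prob_simplex v" and g: "g \<le> 0"
  obtains U where "\<And>\<pi> y. \<pi> \<in> prob_simplex \<Longrightarrow> y \<in> prob_simplex \<Longrightarrow> J g v \<pi> y \<le> U"
proof -
  obtain B where B: "\<And>x. x \<in> prob_simplex \<Longrightarrow> \<bar>v x\<bar> \<le> B"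
    using continuous_on_simplex_bounded[OF v] by blast
  have "J g v \<pi> y \<le> expectation (\<lambda>\<omega>. envelope \<omega> + B)" if "\<pi> \<in> prob_simplex" "y \<in> prob_simplex" for \<pi> y
  proof -
    have "ln (shrinkage c h \<pi> y) \<le> 0" using shrinkage_pos[OF that] shrinkage_le_1[OF that] by simp
    moreover have "entropic_utility M g (payoff v y) \<le> expectation (payoff v y)"
      by (intro entropic_utility_le_expectation integrable_payoff v that g)
    moreover have "expectation (payoff v y) \<le> expectation (\<lambda>\<omega>. envelope \<omega> + B)"
      using payoff_bounds(2)[OF B that(2)] integrable_envelope
      by (intro integral_mono integrable_payoff v that) (auto simp: abs_le_iff)
    ultimately show ?thesis by (simp add: J_def)
  qed
  then show ?thesis using that by blast
qed

text \<open>The supremum is expressed as a least upper bound, because the proofs use its two halves separately.\<close>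

definition solves_bellman :: "real \<Rightarrow> (real^'d \<Rightarrow> real) \<Rightarrow> real \<Rightarrow> bool" where
  "solves_bellman g v \<kappa> \<longleftrightarrow> continuous_on prob_simplex v \<and>
     (\<forall>\<pi>\<in>prob_simplex. (\<forall>y\<in>prob_simplex. J g v \<pi> y \<le> v \<pi> + \<kappa>) \<and>
       (\<forall>u. (\<forall>y\<in>prob_simplex. J g v \<pi> y \<le> u) \<longrightarrow> v \<pi> + \<kappa> \<le> u))"

lemma solves_bellman_continuous: "solves_bellman g v \<kappa> \<Longrightarrow> continuous_on prob_simplex v"
  and solves_bellman_ge: "solves_bellman g v \<kappa> \<Longrightarrow> \<pi> \<in> prob_simplex \<Longrightarrow> y \<in> prob_simplex \<Longrightarrow> J g v \<pi> y \<le> v \<pi> + \<kappa>"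
  and solves_bellman_least: "solves_bellman g v \<kappa> \<Longrightarrow> \<pi> \<in> prob_simplex \<Longrightarrow>
     (\<And>y. y \<in> prob_simplex \<Longrightarrow> J g v \<pi> y \<le> u) \<Longrightarrow> v \<pi> + \<kappa> \<le> u"
  by (auto simp: solves_bellman_def)

lemma bellman_solution_imp_solves:
  assumes sol: "bellman_solution M S \<eta> c h g v lam" and g: "g \<le> 0"
  shows "solves_bellman g v (lam * expectation (\<eta> 1))"
proof -
  let ?k = "lam * expectation (\<eta> 1)"
  have v: "continuous_on prob_simplex v" using sol unfolding bellman_solution_def by blast
  have eq: "v \<pi> = (SUP y\<in>prob_simplex. J g v \<pi> y - ?k)" if "\<pi> \<in> prob_simplex" for \<pi>
    using sol that unfolding bellman_solution_def bellman_objective_eq by blast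
  obtain U where U: "\<And>\<pi> y. \<pi> \<in> prob_simplex \<Longrightarrow> y \<in> prob_simplex \<Longrightarrow> J g v \<pi> y \<le> U"
    using J_bounded[OF v g] by blast
  show ?thesis unfolding solves_bellman_def
  proof (intro conjI ballI allI impI v)
    fix \<pi> :: "real^'d" assume \<pi>: "\<pi> \<in> prob_simplex"
    have bdd: "bdd_above ((\<lambda>y. J g v \<pi> y - ?k) ` prob_simplex)"
      by (rule bdd_aboveI2[of _ _ "U - ?k"]) (use U[OF \<pi>] in auto)
    show "J g v \<pi> y \<le> v \<pi> + ?k" if "y \<in> prob_simplex" for y
      using cSUP_upper[OF that bdd] eq[OF \<pi>] by linarith
    fix u assume u: "\<forall>y\<in>prob_simplex. J g v \<pi> y \<le> u"
    have "(SUP y\<in>prob_simplex. J g v \<pi> y - ?k) \<le> u - ?k"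
      by (rule cSUP_least) (use u prob_simplex_nonempty in auto)
    then show "v \<pi> + ?k \<le> u" using eq[OF \<pi>] by linarith
  qed
qed

lemma solves_bellman_shift:
  assumes "solves_bellman g v \<kappa>" "g \<le> 0"
  shows "solves_bellman g (\<lambda>x. v x + a) \<kappa>"
proof -
  note v = solves_bellman_continuous[OF assms(1)]
  have J: "J g (\<lambda>x. v x + a) \<pi> y = J g v \<pi> y + a" if "y \<in> prob_simplex" for \<pi> y
    by (rule J_add_const[OF v that assms(2)])
  show ?thesis unfolding solves_bellman_def
  proof (intro conjI ballI allI impI)
    show "continuous_on prob_simplex (\<lambda>x. v x + a)" by (intro continuous_intros v)
    fix \<pi> :: "real^'d" assume \<pi>: "\<pi> \<in> prob_simplex"
    show "J g (\<lambda>x. v x + a) \<pi> y \<le> v \<pi> + a + \<kappa>" if "y \<in> prob_simplex" for y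
      using solves_bellman_ge[OF assms(1) \<pi> that] J[OF that] by simp
    fix u assume u: "\<forall>y\<in>prob_simplex. J g (\<lambda>x. v x + a) \<pi> y \<le> u"
    have "v \<pi> + \<kappa> \<le> u - a"
      by (rule solves_bellman_least[OF assms(1) \<pi>]) (use u J in fastforce)
    then show "v \<pi> + a + \<kappa> \<le> u" by simp
  qed
qed

text \<open>Trading from \<open>\<pi>1\<close> to a target that is good from \<open>\<pi>2\<close> changes the objective only through the
  shrinkage factor.\<close>

lemma bellman_difference:
  assumes sol: "solves_bellman g v \<kappa>" and \<pi>: "\<pi>1 \<in> prob_simplex" "\<pi>2 \<in> prob_simplex"
    and d: "\<And>y. y \<in> prob_simplex \<Longrightarrow> ln (shrinkage c h \<pi>2 y) - ln (shrinkage c h \<pi>1 y) \<le> \<delta>"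
  shows "v \<pi>2 - v \<pi>1 \<le> \<delta>"
proof -
  have "v \<pi>2 + \<kappa> \<le> v \<pi>1 + \<kappa> + \<delta>"
  proof (rule solves_bellman_least[OF sol \<pi>(2)])
    fix y :: "real^'d" assume y: "y \<in> prob_simplex"
    show "J g v \<pi>2 y \<le> v \<pi>1 + \<kappa> + \<delta>"
      using solves_bellman_ge[OF sol \<pi>(1) y] d[OF y] unfolding J_def by linarith
  qed
  then show ?thesis by simp
qed

lemma bellman_oscillation:
  assumes sol: "solves_bellman g v \<kappa>" and \<pi>: "\<pi>1 \<in> prob_simplex" "\<pi>2 \<in> prob_simplex"
  shows "v \<pi>2 - v \<pi>1 \<le> - ln (s_bar c h)"
proof (rule bellman_difference[OF sol \<pi>])
  fix y :: "real^'d" assume y: "y \<in> prob_simplex"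
  have "ln (shrinkage c h \<pi>2 y) \<le> 0"
    using shrinkage_pos[OF \<pi>(2) y] shrinkage_le_1[OF \<pi>(2) y] by simp
  moreover have "ln (s_bar c h) \<le> ln (shrinkage c h \<pi>1 y)"
    using shrinkage_ge[OF \<pi>(1) y] s_bar_range by simp
  ultimately show "ln (shrinkage c h \<pi>2 y) - ln (shrinkage c h \<pi>1 y) \<le> - ln (s_bar c h)" by linarith
qed

lemma bellman_Lipschitz:
  assumes sol: "solves_bellman g v \<kappa>" and \<pi>: "\<pi>1 \<in> prob_simplex" "\<pi>2 \<in> prob_simplex"
  shows "v \<pi>2 - v \<pi>1 \<le> c_bar c h / (1 - c_bar c h) / s_bar c h * l1_norm (\<pi>2 - \<pi>1)"
proof (rule bellman_difference[OF sol \<pi>])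
  fix y :: "real^'d" assume y: "y \<in> prob_simplex"
  let ?a = "shrinkage c h \<pi>1 y" and ?b = "shrinkage c h \<pi>2 y" and ?s = "s_bar c h"
  let ?L = "c_bar c h / (1 - c_bar c h) * l1_norm (\<pi>2 - \<pi>1)"
  have ab: "0 < ?a" "0 < ?b" "?s \<le> ?a" "0 < ?s"
    using shrinkage_pos shrinkage_ge s_bar_range \<pi> y by auto
  have L: "0 \<le> ?L" using c_bar_range l1_norm_nonneg[of "\<pi>2 - \<pi>1"] by simp
  have "l1_norm (0 :: real^'d) = 0" by (simp add: l1_norm_def)
  then have le: "?b - ?a \<le> ?L" using shrinkage_Lipschitz[OF \<pi>(2,1) y y] by simp
  have "ln ?b - ln ?a = ln (?b / ?a)" using ab by (simp add: ln_div)
  also have "\<dots> \<le> ?b / ?a - 1" using ab by (intro ln_le_minus_one) simp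
  also have "\<dots> = (?b - ?a) / ?a" using ab by (simp add: field_simps)
  also have "\<dots> \<le> ?L / ?a" using le ab by (intro divide_right_mono) auto
  also have "\<dots> \<le> ?L / ?s" using L ab by (intro divide_left_mono) auto
  finally show "ln ?b - ln ?a \<le> c_bar c h / (1 - c_bar c h) / ?s * l1_norm (\<pi>2 - \<pi>1)"
    by (simp add: mult.commute)
qed

text \<open>Joint continuity at \<open>\<gamma> = 0\<close> in the risk aversion, the value function and the target. A common bound
  for the value functions makes the envelope a majorant for all payoffs, and uniform convergence
  handles the evaluation of \<open>v n\<close> at points that move with \<open>n\<close>.\<close>

lemma tendsto_J:
  assumes g: "\<And>n. g n \<in> {-1..0}" "g \<longlonglongrightarrow> 0"
    and v: "\<And>n. continuous_on prob_simplex (v n)" "continuous_on prob_simplex v'"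
    and B: "\<And>n x. x \<in> prob_simplex \<Longrightarrow> \<bar>v n x\<bar> \<le> B"
    and lim: "uniform_limit prob_simplex v v' sequentially"
    and \<pi>: "\<pi> \<in> prob_simplex" and x: "\<And>n. x n \<in> prob_simplex" "x \<longlonglongrightarrow> y"
  shows "(\<lambda>n. J (g n) (v n) \<pi> (x n)) \<longlonglongrightarrow> J 0 v' \<pi> y"
proof -
  have y: "y \<in> prob_simplex"
    using closed_sequentially[OF compact_imp_closed[OF compact_prob_simplex] x] .
  have "(\<lambda>n. entropic_utility M (g n) (payoff (v n) (x n))) \<longlonglongrightarrow> expectation (payoff v' y)"
  proof (rule tendsto_entropic_utility[OF g])
    show "payoff (v n) (x n) \<in> borel_measurable M" for n by (rule payoff_measurable[OF v(1) x(1)])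
    let ?D = "\<lambda>\<omega>. envelope \<omega> + \<bar>B\<bar> + exp B * exp (- worst \<omega>)"
    show "integrable M ?D"
      using integrable_envelope integrable_exp_worst[of "-1"] by simp
    show "\<bar>payoff (v n) (x n) \<omega>\<bar> \<le> ?D \<omega> \<and> exp (- payoff (v n) (x n) \<omega>) \<le> ?D \<omega>" if "\<omega> \<in> space M" for n \<omega>
    proof
      note b = payoff_bounds[of "v n", OF B x(1)[of n] that]
      have "0 < exp B * exp (- worst \<omega>)" "0 \<le> envelope \<omega>" by (simp_all add: envelope_def)
      then show "\<bar>payoff (v n) (x n) \<omega>\<bar> \<le> ?D \<omega>" using b(2) by linarith
      have "exp (- payoff (v n) (x n) \<omega>) \<le> exp B * exp (- worst \<omega>)"
        using b(1) by (simp add: exp_add[symmetric])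
      then show "exp (- payoff (v n) (x n) \<omega>) \<le> ?D \<omega>" using \<open>0 \<le> envelope \<omega>\<close> by linarith
    qed
    show "(\<lambda>n. payoff (v n) (x n) \<omega>) \<longlonglongrightarrow> payoff v' y \<omega>" if \<omega>: "\<omega> \<in> space M" for \<omega>
    proof -
      have ip: "(\<lambda>n. x n \<bullet> R \<omega>) \<longlonglongrightarrow> y \<bullet> R \<omega>" by (intro tendsto_intros x)
      have pos: "0 < y \<bullet> R \<omega>" by (rule return_pos[OF y \<omega>])
      have "(\<lambda>n. renorm (x n) (R \<omega>)) \<longlonglongrightarrow> renorm y (R \<omega>)"
        unfolding renorm_def using pos by (intro tendsto_intros tendsto_vec_mult x ip) auto
      then have "(\<lambda>n. v n (renorm (x n) (R \<omega>))) \<longlonglongrightarrow> v' (renorm y (R \<omega>))"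
        by (rule tendsto_uniform_limit_moving_point[OF lim v(2) renorm_R_in_simplex[OF x(1) \<omega>] _
              renorm_R_in_simplex[OF y \<omega>]])
      then show ?thesis unfolding payoff_def using pos by (intro tendsto_intros ip) auto
    qed
  qed
  moreover have "(\<lambda>n. ln (shrinkage c h \<pi> (x n))) \<longlonglongrightarrow> ln (shrinkage c h \<pi> y)"
    using shrinkage_pos[OF \<pi> y] by (intro tendsto_ln tendsto_shrinkage \<pi> x y) auto
  ultimately show ?thesis
    unfolding J_def by (auto intro!: tendsto_add simp: entropic_utility_def[of M 0])
qed

end



context rebalancing
begin

text \<open>The inequality survives the limit for each fixed \<open>y\<close>. For the least upper bound, nearly optimal
  portfolios for the \<open>n\<close>-th equation accumulate at some \<open>y\<close>, and joint convergence of \<open>J\<close> shows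
  that \<open>y\<close> attains the value in the limit.\<close>

lemma bellman_limit:
  assumes g: "\<And>n. g n \<in> {-1..0}" "g \<longlonglongrightarrow> 0"
    and sol: "\<And>n. solves_bellman (g n) (v n) (\<kappa> n)"
    and B: "\<And>n x. x \<in> prob_simplex \<Longrightarrow> \<bar>v n x\<bar> \<le> B"
    and lim: "uniform_limit prob_simplex v v' sequentially" "\<kappa> \<longlonglongrightarrow> \<kappa>'"
  shows "solves_bellman 0 v' \<kappa>'"
    and "\<pi> \<in> prob_simplex \<Longrightarrow> \<exists>y\<in>prob_simplex. J 0 v' \<pi> y = v' \<pi> + \<kappa>'"
proof -
  have v: "continuous_on prob_simplex (v n)" for n by (rule solves_bellman_continuous[OF sol])
  have v': "continuous_on prob_simplex v'"
    by (rule uniform_limit_theorem[OF _ lim(1)]) (use v in auto)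
  have val: "(\<lambda>n. v n \<pi> + \<kappa> n) \<longlonglongrightarrow> v' \<pi> + \<kappa>'" if "\<pi> \<in> prob_simplex" for \<pi>
    by (intro tendsto_add lim(2) tendsto_uniform_limitI[OF lim(1) that])
  have up: "J 0 v' \<pi> y \<le> v' \<pi> + \<kappa>'" if \<pi>: "\<pi> \<in> prob_simplex" and y: "y \<in> prob_simplex" for \<pi> y
  proof (rule LIMSEQ_le[OF _ val[OF \<pi>]])
    show "(\<lambda>n. J (g n) (v n) \<pi> y) \<longlonglongrightarrow> J 0 v' \<pi> y"
      by (rule tendsto_J[OF g v v' B lim(1) \<pi> y tendsto_const])
    show "\<exists>N. \<forall>n\<ge>N. J (g n) (v n) \<pi> y \<le> v n \<pi> + \<kappa> n"
      using solves_bellman_ge[OF sol \<pi> y] by blast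
  qed
  have att: "\<exists>y\<in>prob_simplex. J 0 v' \<pi> y = v' \<pi> + \<kappa>'" if \<pi>: "\<pi> \<in> prob_simplex" for \<pi>
  proof -
    \<comment> \<open>Nearly optimal portfolios suffice; the slack vanishes in the limit.\<close>
    have "\<exists>y\<in>prob_simplex. v n \<pi> + \<kappa> n - 1 / real (Suc n) < J (g n) (v n) \<pi> y" for n
    proof (rule ccontr)
      assume "\<not> ?thesis"
      then have "v n \<pi> + \<kappa> n \<le> v n \<pi> + \<kappa> n - 1 / real (Suc n)"
        by (intro solves_bellman_least[OF sol \<pi>]) (auto simp: not_less)
      then show False by simp
    qed
    then obtain x where x: "\<And>n. x n \<in> prob_simplex"
        "\<And>n. v n \<pi> + \<kappa> n - 1 / real (Suc n) < J (g n) (v n) \<pi> (x n)" by metis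
    obtain y r where y: "y \<in> prob_simplex" and r: "strict_mono r" "(x \<circ> r) \<longlonglongrightarrow> y"
      using compact_prob_simplex[unfolded compact_def] x(1) by meson
    have "(\<lambda>n. J ((g \<circ> r) n) ((v \<circ> r) n) \<pi> ((x \<circ> r) n)) \<longlonglongrightarrow> J 0 v' \<pi> y"
    proof (rule tendsto_J[OF _ _ _ v' _ _ \<pi> _ r(2)])
      show "uniform_limit prob_simplex (v \<circ> r) v' sequentially"
        using filterlim_compose[OF lim(1) filterlim_subseq[OF r(1)]] by (simp add: comp_def)
      show "(g \<circ> r) \<longlonglongrightarrow> 0" by (rule LIMSEQ_subseq_LIMSEQ[OF g(2) r(1)])
    qed (use g(1) v B x(1) in auto)
    moreover have "(\<lambda>n. v (r n) \<pi> + \<kappa> (r n) - 1 / real (Suc (r n))) \<longlonglongrightarrow> v' \<pi> + \<kappa>' - 0"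
      using LIMSEQ_subseq_LIMSEQ[OF val[OF \<pi>] r(1)]
        LIMSEQ_subseq_LIMSEQ[OF LIMSEQ_Suc[OF lim_1_over_n] r(1)]
      by (intro tendsto_diff) (simp_all add: comp_def)
    ultimately have "v' \<pi> + \<kappa>' - 0 \<le> J 0 v' \<pi> y"
      by (intro LIMSEQ_le[of _ "v' \<pi> + \<kappa>' - 0" _ "J 0 v' \<pi> y"])
         (use x(2)[of "r _"] in \<open>auto simp: less_imp_le\<close>)
    with up[OF \<pi> y] y show ?thesis by force
  qed
  show "solves_bellman 0 v' \<kappa>'" unfolding solves_bellman_def using v' up att by (metis)
  show "\<pi> \<in> prob_simplex \<Longrightarrow> \<exists>y\<in>prob_simplex. J 0 v' \<pi> y = v' \<pi> + \<kappa>'" by (rule att)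
qed

lemma bellman_attained:
  assumes "solves_bellman 0 v \<kappa>" "\<pi> \<in> prob_simplex"
  shows "\<exists>y\<in>prob_simplex. J 0 v \<pi> y = v \<pi> + \<kappa>"
proof -
  obtain B where B: "\<And>x. x \<in> prob_simplex \<Longrightarrow> \<bar>v x\<bar> \<le> B"
    using continuous_on_simplex_bounded[OF solves_bellman_continuous[OF assms(1)]] by blast
  show ?thesis
    by (rule bellman_limit(2)[of "\<lambda>_. 0" "\<lambda>_. v" "\<lambda>_. \<kappa>" B]) (use assms B in \<open>auto intro: uniform_limit_const\<close>)
qed

section \<open>Affordable portfolios and the concave lift\<close>

definition portfolio :: "real^'d \<Rightarrow> bool" where
  "portfolio y \<longleftrightarrow> (\<forall>i. 0 \<le> y $ i) \<and> y \<noteq> 0"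

text \<open>The logarithm of the concave lift on its natural domain, the nonzero vectors with nonnegative entries.
  It is \<open>payoff_eq\<close> that makes it useful: the payoff is this function at the vector of asset values.\<close>

definition log_lift :: "(real^'d \<Rightarrow> real) \<Rightarrow> real^'d \<Rightarrow> real" where
  "log_lift v x = ln (x \<bullet> 1) + v (x /\<^sub>R (x \<bullet> 1))"

lemma portfolio_pos: "portfolio y \<Longrightarrow> 0 < y \<bullet> 1"
  and portfolio_normalise: "portfolio y \<Longrightarrow> y /\<^sub>R (y \<bullet> 1) \<in> prob_simplex"
  using normalise_in_simplex[of y] by (auto simp: portfolio_def)

lemma portfolio_scale: "0 < a \<Longrightarrow> portfolio y \<Longrightarrow> portfolio (a *\<^sub>R y)"
  by (simp add: portfolio_def)

lemma portfolio_simplex: "y \<in> prob_simplex \<Longrightarrow> portfolio y"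
  using simplexD(1)[of y] simplexD(2)[of y] by (auto simp: portfolio_def)

lemma portfolio_add: "portfolio y \<Longrightarrow> portfolio z \<Longrightarrow> portfolio (y + z)"
proof -
  assume yz: "portfolio y" "portfolio z"
  then have "0 < (y + z) \<bullet> 1" using portfolio_pos by (simp add: inner_add_left add_pos_pos)
  with yz show ?thesis by (auto simp: portfolio_def)
qed

lemma portfolio_mult: "portfolio y \<Longrightarrow> (\<And>i. 0 < a $ i) \<Longrightarrow> portfolio (y * a)"
  unfolding portfolio_def vec_eq_iff
  by (metis less_irrefl mult_eq_0_iff mult_nonneg_nonneg order_less_imp_le vector_mult_component zero_index)

lemma log_lift_scale:
  assumes "portfolio y" "0 < a"
  shows "log_lift v (a *\<^sub>R y) = ln a + log_lift v y"
proof -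
  have "(a *\<^sub>R y) /\<^sub>R (a *\<^sub>R y \<bullet> 1) = y /\<^sub>R (y \<bullet> 1)"
    using assms(2) by (simp add: inverse_mult_distrib mult.commute[of "inverse a"] mult.assoc)
  then show ?thesis
    using portfolio_pos[OF assms(1)] assms(2) by (simp add: log_lift_def ln_mult del: scaleR_scaleR)
qed

lemma log_lift_simplex: "x \<in> prob_simplex \<Longrightarrow> log_lift v x = v x"
  by (simp add: log_lift_def simplexD)

lemma concave_lift_eq: "portfolio y \<Longrightarrow> concave_lift v y = exp (log_lift v y)"
  using portfolio_pos[of y] by (simp add: portfolio_def concave_lift_def log_lift_def exp_add)

text \<open>A concave function that is homogeneous of degree one is superadditive: apply concavity at the midpoint
  and double.\<close>

lemma log_lift_superadditive:
  assumes v: "has_concave_lift v" and yz: "portfolio y" "portfolio z"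
  shows "exp (log_lift v y) + exp (log_lift v z) \<le> exp (log_lift v (y + z))"
proof -
  have yz': "portfolio (y + z)" by (rule portfolio_add[OF yz])
  have "(1 - 1/2) * concave_lift v y + (1/2) * concave_lift v z \<le>
      concave_lift v ((1 - 1/2) *\<^sub>R y + (1/2) *\<^sub>R z)"
    using v yz unfolding has_concave_lift_def concave_on_def
    by (intro concave_onD[of "{x. \<forall>i. 0 \<le> x $ i}"]) (auto simp: concave_on_def portfolio_def)
  also have "(1 - 1/2) *\<^sub>R y + (1/2) *\<^sub>R z = (1/2) *\<^sub>R (y + z)" by (simp add: algebra_simps)
  also have "concave_lift v \<dots> = (1/2) * exp (log_lift v (y + z))"
    using portfolio_scale[OF _ yz', of "1/2"] yz'
    by (simp add: concave_lift_eq log_lift_scale exp_add exp_diff ln_div)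
  finally show ?thesis using yz by (simp add: concave_lift_eq)
qed

lemma payoff_eq: "payoff v y \<omega> = log_lift v (y * R \<omega>)"
  by (simp add: payoff_def log_lift_def renorm_def inner_one inner_vec_def)

lemma portfolio_R: "portfolio y \<Longrightarrow> \<omega> \<in> space M \<Longrightarrow> portfolio (y * R \<omega>)"
  by (rule portfolio_mult) (auto intro: wait_ret_pos)

lemma payoff_scale:
  assumes "portfolio y" "0 < a" "\<omega> \<in> space M"
  shows "payoff v (a *\<^sub>R y) \<omega> = ln a + payoff v y \<omega>"
proof -
  have "a *\<^sub>R y * R \<omega> = a *\<^sub>R (y * R \<omega>)" by (simp add: vec_eq_iff)
  then show ?thesis using log_lift_scale[OF portfolio_R[OF assms(1,3)] assms(2)] by (simp add: payoff_eq)
qed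

lemma payoff_superadditive:
  assumes "has_concave_lift v" "portfolio y" "portfolio z" "\<omega> \<in> space M"
  shows "exp (payoff v y \<omega>) + exp (payoff v z \<omega>) \<le> exp (payoff v (y + z) \<omega>)"
  using log_lift_superadditive[OF assms(1) portfolio_R[OF assms(2,4)] portfolio_R[OF assms(3,4)]]
  by (simp add: payoff_eq distrib_right)

lemma expectation_payoff_scale:
  assumes v: "continuous_on prob_simplex v" and x: "x \<in> prob_simplex" and w: "0 < w"
  shows "integrable M (payoff v (w *\<^sub>R x))"
    and "expectation (payoff v (w *\<^sub>R x)) = ln w + expectation (payoff v x)"
proof -
  have eq: "payoff v (w *\<^sub>R x) \<omega> = ln w + payoff v x \<omega>" if "\<omega> \<in> space M" for \<omega>
    by (rule payoff_scale[OF portfolio_simplex[OF x] w that])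
  have i: "integrable M (\<lambda>\<omega>. ln w + payoff v x \<omega>)" using integrable_payoff(1)[OF v x] by simp
  show "integrable M (payoff v (w *\<^sub>R x))"
    using i by (rule Bochner_Integration.integrable_cong[OF refl, THEN iffD1, rotated]) (simp add: eq)
  have "expectation (payoff v (w *\<^sub>R x)) = expectation (\<lambda>\<omega>. ln w + payoff v x \<omega>)"
    by (rule Bochner_Integration.integral_cong[OF refl eq])
  also have "\<dots> = ln w + expectation (payoff v x)"
    using integrable_payoff(1)[OF v x] by (simp add: prob_space)
  finally show "expectation (payoff v (w *\<^sub>R x)) = ln w + expectation (payoff v x)" .
qed

definition affordable :: "real^'d \<Rightarrow> real^'d \<Rightarrow> bool" where
  "affordable \<pi> y \<longleftrightarrow> portfolio y \<and> y \<bullet> 1 + cost_fun c h (y - \<pi>) \<le> 1"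

text \<open>By homogeneity of the lift, the factor \<open>ln s(\<pi>,x)\<close> of the objective is the price of scaling \<open>x\<close> up
  to the boundary of the budget set. Maximising \<open>J\<close> over the simplex is therefore the same as
  maximising the mean payoff over affordable portfolios, which form a convex set.\<close>

lemma affordable_le_value:
  assumes sol: "solves_bellman 0 v \<kappa>" and \<pi>: "\<pi> \<in> prob_simplex" and y: "affordable \<pi> y"
  shows "integrable M (payoff v y)" "expectation (payoff v y) \<le> v \<pi> + \<kappa>"
proof -
  note v = solves_bellman_continuous[OF sol]
  define w where "w = y \<bullet> 1"
  define x where "x = y /\<^sub>R w"
  have w: "0 < w" and x: "x \<in> prob_simplex"
    using y portfolio_pos portfolio_normalise by (auto simp: affordable_def w_def x_def)
  have yx: "y = w *\<^sub>R x" using w by (simp add: x_def)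
  show "integrable M (payoff v y)" unfolding yx by (rule expectation_payoff_scale(1)[OF v x w])
  have "w + cost_fun c h (y - \<pi>) \<le> 1" using y by (simp add: affordable_def w_def)
  then have "w + cost_fun c h (w *\<^sub>R x - \<pi>) \<le> 1" by (simp only: yx[symmetric])
  then have "w \<le> shrinkage c h \<pi> x" by (rule feasible_le_shrinkage[OF \<pi> x])
  then have "ln w \<le> ln (shrinkage c h \<pi> x)" using w by simp
  then have "expectation (payoff v y) \<le> J 0 v \<pi> x"
    unfolding yx expectation_payoff_scale(2)[OF v x w] by (simp add: J_def entropic_utility_def)
  also have "\<dots> \<le> v \<pi> + \<kappa>" by (rule solves_bellman_ge[OF sol \<pi> x])
  finally show "expectation (payoff v y) \<le> v \<pi> + \<kappa>" .
qed

lemma shrinkage_affordable: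
  assumes v: "continuous_on prob_simplex v" and \<pi>: "\<pi> \<in> prob_simplex" and x: "x \<in> prob_simplex"
  shows "affordable \<pi> (shrinkage c h \<pi> x *\<^sub>R x)"
    and "expectation (payoff v (shrinkage c h \<pi> x *\<^sub>R x)) = J 0 v \<pi> x"
  using shrinkage_pos[OF \<pi> x] shrinkage_eq[OF \<pi> x] portfolio_simplex[OF x]
  by (simp_all add: affordable_def portfolio_scale simplexD(2)[OF x] expectation_payoff_scale[OF v x]
      J_def entropic_utility_def)

lemma portfolio_axis: "portfolio (axis i 1)"
  by (rule portfolio_simplex[OF axis_in_simplex])

lemma payoff_axis:
  assumes "\<omega> \<in> space M"
  shows "payoff v (axis i 1) \<omega> = ln (R \<omega> $ i) + v (axis i 1)"
proof -
  have "axis i 1 * R \<omega> = (R \<omega> $ i) *\<^sub>R axis i 1"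
    by (auto simp: vec_eq_iff axis_def)
  then show ?thesis
    by (simp add: payoff_eq log_lift_scale[OF portfolio_axis wait_ret_pos[OF assms]]
        log_lift_simplex[OF axis_in_simplex])
qed

end



context rebalancing
begin

section \<open>Maximisers for the risk-neutral criterion\<close>

text \<open>Suppose asset \<open>i\<close> is missing from the optimal portfolio \<open>y = w x\<close>. Buy \<open>\<epsilon>\<close> units of wealth of it and
  scale \<open>y\<close> down by \<open>1 - K \<epsilon>\<close> to stay affordable. Superadditivity of the lift and the oscillation bound
  show that the payoff grows at least by \<open>ln (1 + \<epsilon> (a X - K))\<close> with \<open>X = R\<^sub>i / \<langle>x,R\<rangle>\<close> and
  \<open>a = s_bar / w\<close>. Optimality bounds the mean of this by \<open>0\<close>; dividing by \<open>\<epsilon>\<close> and letting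
  \<open>\<epsilon> \<rightarrow> 0\<close>, Fatou's lemma gives \<open>E[X] \<le> K / a = 1 / s_bar\<^sup>2\<close>, whereas
  the growth condition asks for more than \<open>(1 + C) / s_bar \<ge> 1 / s_bar\<^sup>2\<close>. Fatou's
  lemma is the right tool because the mean of \<open>X\<close> is not known to be finite beforehand.\<close>

lemma optimiser_interior:
  assumes sol: "solves_bellman 0 v \<kappa>" and conc: "has_concave_lift v"
    and growth: "growth_cond M S \<eta> c h"
    and \<pi>: "\<pi> \<in> prob_simplex" and x: "x \<in> prob_simplex" and opt: "J 0 v \<pi> x = v \<pi> + \<kappa>"
  shows "x \<in> open_prob_simplex"
proof (rule ccontr)
  note v = solves_bellman_continuous[OF sol]
  assume "x \<notin> open_prob_simplex"
  then obtain i where "x $ i = 0"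
    using x simplexD(1)[OF x] by (force simp: open_prob_simplex_def less_le)
  let ?s = "s_bar c h"
  define w where "w = shrinkage c h \<pi> x"
  define y where "y = w *\<^sub>R x"
  \<comment> \<open>Buying costs at most \<open>1 + c_bar\<close> per unit and scaling down frees at least \<open>1 - c_bar\<close> per unit, whence \<open>K w (1 - c_bar) = 1 + c_bar\<close>.\<close>
  define K where "K = 1 / (?s * w)"
  define a where "a = ?s / w"
  define X where "X \<omega> = R \<omega> $ i / (x \<bullet> R \<omega>)" for \<omega>
  have s: "0 < ?s" "?s \<le> 1" by (rule s_bar_range)+
  have w: "0 < w" unfolding w_def by (rule shrinkage_pos[OF \<pi> x])
  have K: "0 < K" and a: "0 < a" using s w by (simp_all add: K_def a_def)
  have y: "affordable \<pi> y" "expectation (payoff v y) = v \<pi> + \<kappa>"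
    using shrinkage_affordable[OF v \<pi> x] opt by (simp_all add: y_def w_def)
  then have py: "portfolio y" by (simp add: affordable_def)
  have y1: "y \<bullet> 1 = w" using simplexD(2)[OF x] by (simp add: y_def)
  have Xpos: "0 < X \<omega>" if "\<omega> \<in> space M" for \<omega>
    using wait_ret_pos[OF that, of i] return_pos[OF x that] by (simp add: X_def)
  have [measurable]: "X \<in> borel_measurable M"
    unfolding X_def using borel_measurable_vec_component[OF wait_ret_measurable, of i] by measurable
  have gain: "ln (1 + \<epsilon> * (a * X \<omega> - K)) \<le> payoff v ((1 - K * \<epsilon>) *\<^sub>R y + \<epsilon> *\<^sub>R axis i 1) \<omega> - payoff v y \<omega>"
    if \<omega>: "\<omega> \<in> space M" and \<epsilon>: "0 < \<epsilon>" "K * \<epsilon> < 1" for \<omega> \<epsilon>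
  proof -
    have ne: "0 < 1 - K * \<epsilon>" using \<epsilon> by simp
    have p1: "exp (payoff v ((1 - K * \<epsilon>) *\<^sub>R y) \<omega>) = (1 - K * \<epsilon>) * exp (payoff v y \<omega>)"
      using payoff_scale[OF py ne \<omega>] ne by (simp add: exp_add)
    have p2: "exp (payoff v (\<epsilon> *\<^sub>R axis i 1) \<omega>) = \<epsilon> * R \<omega> $ i * exp (v (axis i 1))"
      using payoff_scale[OF portfolio_axis \<epsilon>(1) \<omega>] \<epsilon> wait_ret_pos[OF \<omega>, of i]
      by (simp add: payoff_axis[OF \<omega>] exp_add)
    have py_eq: "exp (payoff v y \<omega>) = w * (x \<bullet> R \<omega>) * exp (v (renorm x (R \<omega>)))"
      unfolding y_def payoff_scale[OF portfolio_simplex[OF x] w \<omega>]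
      using w return_pos[OF x \<omega>] by (simp add: payoff_def exp_add)
    have "v (renorm x (R \<omega>)) - v (axis i 1) \<le> - ln ?s"
      by (rule bellman_oscillation[OF sol axis_in_simplex renorm_R_in_simplex[OF x \<omega>]])
    then have "exp (ln ?s + v (renorm x (R \<omega>))) \<le> exp (v (axis i 1))" by simp
    then have "?s * exp (v (renorm x (R \<omega>))) \<le> exp (v (axis i 1))" using s by (simp add: exp_add)
    then have "\<epsilon> * R \<omega> $ i * (?s * exp (v (renorm x (R \<omega>)))) \<le> \<epsilon> * R \<omega> $ i * exp (v (axis i 1))"
      using \<epsilon> wait_ret_pos[OF \<omega>, of i] by (intro mult_left_mono) auto
    also have "\<epsilon> * R \<omega> $ i * (?s * exp (v (renorm x (R \<omega>)))) = \<epsilon> * (a * X \<omega>) * exp (payoff v y \<omega>)"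
      using w return_pos[OF x \<omega>] by (simp add: py_eq a_def X_def)
    finally have "\<epsilon> * (a * X \<omega>) * exp (payoff v y \<omega>) \<le> exp (payoff v (\<epsilon> *\<^sub>R axis i 1) \<omega>)"
      by (simp only: p2)
    then have "(1 + \<epsilon> * (a * X \<omega> - K)) * exp (payoff v y \<omega>) \<le>
        exp (payoff v ((1 - K * \<epsilon>) *\<^sub>R y) \<omega>) + exp (payoff v (\<epsilon> *\<^sub>R axis i 1) \<omega>)"
      unfolding p1 by (simp add: algebra_simps)
    also have "\<dots> \<le> exp (payoff v ((1 - K * \<epsilon>) *\<^sub>R y + \<epsilon> *\<^sub>R axis i 1) \<omega>)"
      by (rule payoff_superadditive[OF conc portfolio_scale[OF ne py] portfolio_scale[OF \<epsilon>(1) portfolio_axis] \<omega>])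
    finally have le: "(1 + \<epsilon> * (a * X \<omega> - K)) * exp (payoff v y \<omega>) \<le> \<dots>" .
    have "0 < 1 - K * \<epsilon> + \<epsilon> * (a * X \<omega>)" using ne \<epsilon> a Xpos[OF \<omega>] by (simp add: add_pos_pos)
    then have pos: "0 < 1 + \<epsilon> * (a * X \<omega> - K)" by (simp add: algebra_simps)
    then have "0 < (1 + \<epsilon> * (a * X \<omega> - K)) * exp (payoff v y \<omega>)" by simp
    from ln_mono[OF le this] show ?thesis
      using pos by (simp add: ln_mult)
  qed
  have aff: "affordable \<pi> ((1 - K * \<epsilon>) *\<^sub>R y + \<epsilon> *\<^sub>R axis i 1)"
    if \<epsilon>: "0 < \<epsilon>" "K * \<epsilon> < 1" for \<epsilon>
  proof -
    let ?z = "(1 - K * \<epsilon>) *\<^sub>R y + \<epsilon> *\<^sub>R axis i 1"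
    have pz: "portfolio ?z" using \<epsilon> py by (intro portfolio_add portfolio_scale portfolio_axis) auto
    have z1: "?z \<bullet> 1 = (1 - K * \<epsilon>) * w + \<epsilon>"
      using simplexD(2)[OF axis_in_simplex[of i]] by (simp add: inner_add_left y1)
    have d: "?z - \<pi> - (y - \<pi>) = (- (K * \<epsilon>)) *\<^sub>R y + \<epsilon> *\<^sub>R axis i 1" by (simp add: algebra_simps)
    have l: "l1_norm ((- (K * \<epsilon>)) *\<^sub>R y + \<epsilon> *\<^sub>R axis i 1) \<le> K * \<epsilon> * w + \<epsilon>"
    proof -
      have "l1_norm y = w" "l1_norm (axis i 1 :: real^'d) = 1"
        using w by (simp_all add: y_def l1_norm_scaleR l1_norm_simplex x axis_in_simplex)
      then show ?thesis
        using l1_norm_triangle[of "(- (K * \<epsilon>)) *\<^sub>R y" "\<epsilon> *\<^sub>R axis i 1"] K \<epsilon>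
        by (simp add: l1_norm_scaleR abs_mult del: scaleR_minus_left)
    qed
    have "cost_fun c h (?z - \<pi>) - cost_fun c h (y - \<pi>) \<le> c_bar c h * (K * \<epsilon> * w + \<epsilon>)"
      using cost_Lipschitz[of "?z - \<pi>" "y - \<pi>", unfolded d] mult_left_mono[OF l c_bar_range(1)]
      by linarith
    moreover have Kw: "K * w = (1 + c_bar c h) / (1 - c_bar c h)"
      using w c_bar_range by (simp add: K_def s_bar_def)
    have "(1 - c_bar c h) * (K * w) = 1 + c_bar c h"
      unfolding Kw using c_bar_range by simp
    then have "\<epsilon> * ((1 - c_bar c h) * (K * w)) = \<epsilon> * (1 + c_bar c h)" by simp
    moreover have "w + cost_fun c h (y - \<pi>) \<le> 1" using y(1) by (simp add: affordable_def y1)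
    ultimately have "?z \<bullet> 1 + cost_fun c h (?z - \<pi>) \<le> 1"
      unfolding z1 by (simp add: algebra_simps)
    with pz show ?thesis by (simp add: affordable_def)
  qed
  \<comment> \<open>A null sequence with \<open>K e \<le> 1/2\<close>, so that the logarithms below stay bounded from below by \<open>- 2 K e\<close>.\<close>
  define e where "e n = 1 / (2 * K * real (Suc n))" for n
  have e: "0 < e n" "K * e n \<le> 1 / 2" for n
  proof -
    show "0 < e n" unfolding e_def using K by (intro divide_pos_pos mult_pos_pos) auto
    have "K * e n = 1 / 2 * (1 / real (Suc n))" unfolding e_def using K by simp
    also have "\<dots> \<le> 1 / 2 * 1" by (intro mult_left_mono) auto
    finally show "K * e n \<le> 1 / 2" by simp
  qed
  have e0: "e \<longlonglongrightarrow> 0"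
  proof -
    have "(\<lambda>n. 1 / (2 * K) * (1 / real (Suc n))) \<longlonglongrightarrow> 1 / (2 * K) * 0"
      by (intro tendsto_mult tendsto_const LIMSEQ_Suc[OF lim_1_over_n])
    then show ?thesis by (simp add: e_def[abs_def])
  qed
  \<comment> \<open>The summand \<open>2 K\<close> makes the difference quotients nonnegative, as Fatou's lemma requires.\<close>
  let ?q = "\<lambda>n \<omega>. ln (1 + e n * (a * X \<omega> - K)) / e n + 2 * K"
  have bound: "(\<integral>\<^sup>+\<omega>. ennreal (?q n \<omega>) \<partial>M) \<le> ennreal (2 * K)" for n
  proof -
    let ?z = "(1 - K * e n) *\<^sub>R y + e n *\<^sub>R axis i 1"
    let ?L = "\<lambda>\<omega>. (payoff v ?z \<omega> - payoff v y \<omega>) / e n + 2 * K"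
    have Ke: "K * e n < 1" using e(2)[of n] by simp
    have qL: "?q n \<omega> \<le> ?L \<omega>" and q0: "0 \<le> ?q n \<omega>" if "\<omega> \<in> space M" for \<omega>
    proof -
      show "?q n \<omega> \<le> ?L \<omega>"
        using gain[OF that e(1) Ke] e(1)[of n] by (simp add: divide_right_mono)
      have "- (K * e n) - 2 * (K * e n)\<^sup>2 \<le> ln (1 - K * e n)"
        using K e by (intro ln_one_minus_pos_lower_bound) (auto simp: less_imp_le)
      moreover have "2 * (K * e n)\<^sup>2 \<le> K * e n"
        using mult_left_mono[OF e(2)[of n], of "2 * (K * e n)"] K e(1)[of n]
        by (simp add: power2_eq_square)
      moreover have "ln (1 - K * e n) \<le> ln (1 + e n * (a * X \<omega> - K))"
        using Ke a Xpos[OF that] e(1)[of n] by (intro ln_mono) (auto simp: right_diff_distrib mult.commute)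
      ultimately have "- (2 * K) * e n \<le> ln (1 + e n * (a * X \<omega> - K))" by linarith
      then have "- (2 * K) \<le> ln (1 + e n * (a * X \<omega> - K)) / e n"
        using e(1)[of n] by (simp add: pos_le_divide_eq)
      then show "0 \<le> ?q n \<omega>" by simp
    qed
    note az = affordable_le_value[OF sol \<pi> aff[OF e(1) Ke]] and ay = affordable_le_value(1)[OF sol \<pi> y(1)]
    have "(\<integral>\<^sup>+\<omega>. ennreal (?q n \<omega>) \<partial>M) \<le> (\<integral>\<^sup>+\<omega>. ennreal (?L \<omega>) \<partial>M)"
      using qL by (intro nn_integral_mono ennreal_leI)
    also have "\<dots> = ennreal (expectation ?L)"
      using az ay order_trans[OF q0 qL] by (intro nn_integral_eq_integral AE_I2) auto
    also have "expectation ?L = (expectation (payoff v ?z) - expectation (payoff v y)) / e n + 2 * K"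
      using az(1) ay by (simp add: prob_space)
    also have "\<dots> \<le> 2 * K"
      using az(2) y(2) e(1)[of n] by (simp add: divide_le_0_iff)
    finally show ?thesis by (simp add: ennreal_leI)
  qed
  have qlim: "(\<lambda>n. ?q n \<omega>) \<longlonglongrightarrow> a * X \<omega> + K" for \<omega>
  proof -
    let ?u = "a * X \<omega> - K"
    have "(\<lambda>n. e n * ?u) \<longlonglongrightarrow> 0 * ?u" by (intro tendsto_mult e0 tendsto_const)
    then have "(\<lambda>n. ln_quotient (e n * ?u)) \<longlonglongrightarrow> 1"
      by (intro filterlim_compose[OF tendsto_ln_quotient]) simp
    then have "(\<lambda>n. ?u * ln_quotient (e n * ?u) + 2 * K) \<longlonglongrightarrow> ?u * 1 + 2 * K"
      by (intro tendsto_intros)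
    moreover have "?u * ln_quotient (e n * ?u) = ln (1 + e n * ?u) / e n" for n
      using e(1)[of n] by (simp add: ln_quotient_def)
    ultimately show ?thesis by (simp add: add.commute)
  qed
  have [measurable]: "(\<lambda>\<omega>. ?q n \<omega>) \<in> borel_measurable M" for n by measurable
  have "(\<integral>\<^sup>+\<omega>. ennreal (a * X \<omega> + K) \<partial>M) = (\<integral>\<^sup>+\<omega>. liminf (\<lambda>n. ennreal (?q n \<omega>)) \<partial>M)"
    by (intro nn_integral_cong lim_imp_Liminf[symmetric] tendsto_ennrealI qlim) simp
  also have "\<dots> \<le> liminf (\<lambda>n. \<integral>\<^sup>+\<omega>. ennreal (?q n \<omega>) \<partial>M)"
    by (rule nn_integral_liminf) measurable
  also have "\<dots> \<le> liminf (\<lambda>n::nat. ennreal (2 * K))"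
    by (rule Liminf_mono) (simp add: bound)
  also have "\<dots> = ennreal (2 * K)" by (simp add: Liminf_const)
  finally have le2K: "(\<integral>\<^sup>+\<omega>. ennreal (a * X \<omega> + K) \<partial>M) \<le> ennreal (2 * K)" .
  have nn: "(\<integral>\<^sup>+\<omega>. ennreal (a * X \<omega> + K) \<partial>M) < \<infinity>"
    using le2K by (simp add: order_le_less_trans[OF _ ennreal_less_top] top.not_eq_extremum)
  have i1: "integrable M (\<lambda>\<omega>. a * X \<omega> + K)"
    by (rule integrableI_nonneg) (use nn Xpos a K in \<open>auto intro!: AE_I2 less_imp_le add_pos_pos\<close>)
  then have "integrable M (\<lambda>\<omega>. inverse a * (a * X \<omega> + K - K))"
    by (intro integrable_mult_right Bochner_Integration.integrable_diff) auto
  then have iX: "integrable M X" using a by (simp add: mult.assoc[symmetric])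
  have "expectation (\<lambda>\<omega>. a * X \<omega> + K) \<le> 2 * K"
    using le2K nn_integral_eq_integral[OF i1] Xpos a K
    by (auto simp: AE_I2 less_imp_le add_pos_pos)
  then have "a * expectation X \<le> K" using iX by (simp add: prob_space)
  then have EX: "expectation X \<le> 1 / ?s / ?s"
    using w s by (simp add: a_def K_def field_simps)
  have nnX: "(\<integral>\<^sup>+\<omega>. ennreal (X \<omega>) \<partial>M) = ennreal (expectation X)"
    using Xpos by (intro nn_integral_eq_integral iX AE_I2 less_imp_le)
  have "(\<integral>\<^sup>+\<omega>. ennreal (R \<omega> $ i * (x \<bullet> R \<omega>) powr (0 - 1)) \<partial>M) = (\<integral>\<^sup>+\<omega>. ennreal (X \<omega>) \<partial>M)"
    using return_pos[OF x] by (intro nn_integral_cong) (simp add: X_def powr_minus_divide abs_of_pos)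
  moreover have "(\<integral>\<^sup>+\<omega>. ennreal ((x \<bullet> R \<omega>) powr 0) \<partial>M) = (\<integral>\<^sup>+\<omega>. 1 \<partial>M)"
    using return_pos[OF x] by (intro nn_integral_cong) (simp add: less_imp_neq[symmetric])
  then have "(\<integral>\<^sup>+\<omega>. ennreal ((x \<bullet> R \<omega>) powr 0) \<partial>M) = 1" by (simp add: emeasure_space_1)
  moreover have "(\<integral>\<^sup>+\<omega>. ennreal (R \<omega> $ i * (x \<bullet> R \<omega>) powr (0 - 1)) \<partial>M) /
        (\<integral>\<^sup>+\<omega>. ennreal ((x \<bullet> R \<omega>) powr 0) \<partial>M)
        > ennreal (?s powr (0 - 1) * (1 + 2 * (c_bar c h / (1 - c_bar c h)) / ?s))"
    using growth[unfolded growth_cond_def Let_def] \<open>x $ i = 0\<close> x by blast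
  ultimately have "ennreal (?s powr (0 - 1) * (1 + 2 * (c_bar c h / (1 - c_bar c h)) / ?s)) < ennreal (expectation X)"
    by (simp add: nnX divide_ennreal_def)
  then have "?s powr (0 - 1) * (1 + 2 * (c_bar c h / (1 - c_bar c h)) / ?s) < expectation X"
    by (simp add: ennreal_less_iff s(1) c_bar_range less_imp_le)
  moreover have "?s powr (0 - 1) = 1 / ?s" using s by (simp add: powr_minus_divide)
  ultimately have gt: "1 / ?s * (1 + 2 * (c_bar c h / (1 - c_bar c h)) / ?s) < expectation X"
    by (simp only:)
  have "1 / ?s / ?s \<le> 1 / ?s * (1 + 2 * (c_bar c h / (1 - c_bar c h)) / ?s)"
  proof -
    let ?b = "c_bar c h"
    have "2 * (?b / (1 - ?b)) \<le> 2 * (?b / (1 - ?b)) / ?s"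
      using s c_bar_range by (simp add: pos_le_divide_eq mult_left_le)
    moreover have "1 / ?s = 1 + 2 * (?b / (1 - ?b))"
      using c_bar_range by (simp add: s_bar_def field_simps)
    ultimately have "1 / ?s \<le> 1 + 2 * (?b / (1 - ?b)) / ?s" by linarith
    from mult_left_mono[OF this, of "1 / ?s"] show ?thesis using s by simp
  qed
  from leD[OF EX] le_less_trans[OF this gt] show False by contradiction
qed

end



context rebalancing
begin

lemma continuous_on_log_lift_scaled:
  assumes v: "continuous_on prob_simplex v" and a: "\<And>i. 0 < a $ i"
  shows "continuous_on prob_simplex (\<lambda>z. log_lift v (a * z))"
proof -
  have p: "portfolio (a * z)" if "z \<in> prob_simplex" for z
    using portfolio_mult[OF portfolio_simplex[OF that] a] by (simp add: mult.commute)
  have cm: "continuous_on prob_simplex (\<lambda>z. a * z)"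
    unfolding continuous_on_def by (auto intro!: tendsto_vec_mult)
  have pos: "\<forall>z\<in>prob_simplex. (a * z) \<bullet> 1 \<noteq> 0" using portfolio_pos[OF p] by force
  have "continuous_on prob_simplex (\<lambda>z. v ((a * z) /\<^sub>R ((a * z) \<bullet> 1)))"
    by (rule continuous_on_compose2[OF v])
       (use pos portfolio_normalise[OF p] in \<open>auto intro!: continuous_intros cm\<close>)
  moreover have "continuous_on prob_simplex (\<lambda>z. ln ((a * z) \<bullet> 1))"
    using pos by (intro continuous_intros cm) auto
  ultimately show ?thesis unfolding log_lift_def by (rule continuous_on_add[rotated])
qed

text \<open>Strict concavity of the logarithm makes the midpoint of two optimal portfolios strictly better, unless
  the lift takes the same value on \<open>y1 * R\<close> and \<open>y2 * R = a * (y1 * R)\<close> almost surely. Then full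
  support propagates the identity \<open>log_lift v x = log_lift v (a * x)\<close> to all \<open>x\<close>. On the unit vectors
  homogeneity turns it into \<open>ln (a $ i) = 0\<close>.\<close>

lemma optimiser_unique:
  assumes sol: "solves_bellman 0 v \<kappa>" and conc: "has_concave_lift v"
    and growth: "growth_cond M S \<eta> c h" and full: "full_support_cond M S"
    and \<pi>: "\<pi> \<in> prob_simplex"
    and x1: "x1 \<in> prob_simplex" "J 0 v \<pi> x1 = v \<pi> + \<kappa>"
    and x2: "x2 \<in> prob_simplex" "J 0 v \<pi> x2 = v \<pi> + \<kappa>"
  shows "x1 = x2"
proof -
  note v = solves_bellman_continuous[OF sol]
  have int1: "x1 \<in> open_prob_simplex" and int2: "x2 \<in> open_prob_simplex"
    by (rule optimiser_interior[OF sol conc growth \<pi> x1] optimiser_interior[OF sol conc growth \<pi> x2])+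
  define s1 where "s1 = shrinkage c h \<pi> x1"
  define s2 where "s2 = shrinkage c h \<pi> x2"
  define y1 where "y1 = s1 *\<^sub>R x1"
  define y2 where "y2 = s2 *\<^sub>R x2"
  have s: "0 < s1" "0 < s2" using shrinkage_pos \<pi> x1 x2 by (auto simp: s1_def s2_def)
  have y1: "affordable \<pi> y1" "expectation (payoff v y1) = v \<pi> + \<kappa>"
    and y2: "affordable \<pi> y2" "expectation (payoff v y2) = v \<pi> + \<kappa>"
    using shrinkage_affordable[OF v \<pi>] x1 x2 by (simp_all add: y1_def y2_def s1_def s2_def)
  have p: "portfolio y1" "portfolio y2" using y1 y2 by (simp_all add: affordable_def)
  have i: "integrable M (payoff v y1)" "integrable M (payoff v y2)"
    by (rule affordable_le_value(1)[OF sol \<pi> y1(1)] affordable_le_value(1)[OF sol \<pi> y2(1)])+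
  define m where "m = (1/2) *\<^sub>R y1 + (1/2) *\<^sub>R y2"
  have "affordable \<pi> m"
  proof -
    have pm: "portfolio m" unfolding m_def by (intro portfolio_add portfolio_scale p) auto
    have "m - \<pi> = (1/2) *\<^sub>R (y1 - \<pi>) + (1/2) *\<^sub>R (y2 - \<pi>)"
      unfolding m_def by (simp add: algebra_simps flip: scaleR_add_left)
    then have "cost_fun c h (m - \<pi>) \<le> (1/2) * cost_fun c h (y1 - \<pi>) + (1/2) * cost_fun c h (y2 - \<pi>)"
      using cost_triangle[of "(1/2) *\<^sub>R (y1 - \<pi>)" "(1/2) *\<^sub>R (y2 - \<pi>)"] by (simp add: cost_scaleR)
    moreover have "m \<bullet> 1 = (1/2) * (y1 \<bullet> 1) + (1/2) * (y2 \<bullet> 1)"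
      by (simp add: m_def inner_add_left)
    ultimately show ?thesis using y1(1) y2(1) pm unfolding affordable_def by linarith
  qed
  note m = affordable_le_value[OF sol \<pi> this]
  define N where "N \<omega> = payoff v m \<omega> - (payoff v y1 \<omega> + payoff v y2 \<omega>) / 2" for \<omega>
  have mid: "(exp (payoff v y1 \<omega>) + exp (payoff v y2 \<omega>)) / 2 \<le> exp (payoff v m \<omega>)" if \<omega>: "\<omega> \<in> space M" for \<omega>
  proof -
    have half: "exp (payoff v ((1/2) *\<^sub>R y) \<omega>) = exp (payoff v y \<omega>) / 2" if "portfolio y" for y
      using payoff_scale[OF that _ \<omega>, of "1/2"] by (simp add: exp_add exp_diff ln_div)
    show ?thesis
      using payoff_superadditive[OF conc portfolio_scale[OF _ p(1)] portfolio_scale[OF _ p(2)] \<omega>, of "1/2" "1/2"]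
      unfolding half[OF p(1)] half[OF p(2)] m_def by (simp add: add_divide_distrib)
  qed
  \<comment> \<open>The arithmetic mean exceeds the geometric one by half the squared difference of the square roots.\<close>
  have sq: "(exp (payoff v y1 \<omega>) + exp (payoff v y2 \<omega>)) / 2 =
      exp ((payoff v y1 \<omega> + payoff v y2 \<omega>) / 2) +
      (exp (payoff v y1 \<omega> / 2) - exp (payoff v y2 \<omega> / 2))\<^sup>2 / 2" for \<omega>
  proof -
    have e: "exp t = (exp (t / 2))\<^sup>2" for t :: real
      by (simp add: power2_eq_square flip: exp_add)
    have "exp ((payoff v y1 \<omega> + payoff v y2 \<omega>) / 2) = exp (payoff v y1 \<omega> / 2) * exp (payoff v y2 \<omega> / 2)"
      by (simp add: add_divide_distrib exp_add)
    then show ?thesis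
      by (simp add: e[of "payoff v y1 \<omega>"] e[of "payoff v y2 \<omega>"] power2_diff add_divide_distrib diff_divide_distrib)
  qed
  have N0: "0 \<le> N \<omega>" if "\<omega> \<in> space M" for \<omega>
  proof -
    have "exp ((payoff v y1 \<omega> + payoff v y2 \<omega>) / 2) \<le> exp (payoff v m \<omega>)"
      using mid[OF that] sq[of \<omega>] zero_le_power2[of "exp (payoff v y1 \<omega> / 2) - exp (payoff v y2 \<omega> / 2)"]
      by linarith
    then show ?thesis by (simp add: N_def)
  qed
  have Ni: "integrable M N" unfolding N_def using i m by simp
  have "expectation N \<le> 0"
    unfolding N_def using i m y1 y2 by simp
  moreover have "0 \<le> expectation N" using N0 by (intro integral_nonneg_AE AE_I2)
  ultimately have "expectation N = 0" by simp
  then have AE_N: "AE \<omega> in M. N \<omega> = 0"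
    using integral_nonneg_eq_0_iff_AE[OF Ni] N0 by (simp add: AE_I2)
  have N_eq: "payoff v y1 \<omega> = payoff v y2 \<omega>" if \<omega>: "\<omega> \<in> space M" "N \<omega> = 0" for \<omega>
  proof -
    have "payoff v m \<omega> = (payoff v y1 \<omega> + payoff v y2 \<omega>) / 2" using \<omega>(2) by (simp add: N_def)
    then have "exp (payoff v m \<omega>) = exp ((payoff v y1 \<omega> + payoff v y2 \<omega>) / 2)" by (simp only:)
    then have "(exp (payoff v y1 \<omega> / 2) - exp (payoff v y2 \<omega> / 2))\<^sup>2 \<le> 0"
      using mid[OF \<omega>(1)] sq[of \<omega>] by linarith
    then show ?thesis by simp
  qed
  from AE_space AE_N have AE_eq: "AE \<omega> in M. payoff v y1 \<omega> = payoff v y2 \<omega>"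
    by eventually_elim (rule N_eq)
  define a where "a = (\<chi> i. y2 $ i / y1 $ i)"
  have xpos: "0 < x1 $ i" "0 < x2 $ i" for i
    using int1 int2 by (simp_all add: open_prob_simplex_def)
  then have ypos: "0 < y1 $ i" "0 < y2 $ i" for i using s by (simp_all add: y1_def y2_def)
  have a: "0 < a $ i" for i using ypos by (simp add: a_def)
  have ay: "a * y1 = y2" using ypos by (simp add: a_def vec_eq_iff less_imp_neq[symmetric])
  have eq: "v z = log_lift v (a * z)" if z: "z \<in> prob_simplex" for z
  proof -
    have "\<bar>v z - log_lift v (a * z)\<bar> = 0"
    proof (rule full_support_at_waiting_time[OF full int1 _ _ _ z])
      show "continuous_on prob_simplex (\<lambda>z. \<bar>v z - log_lift v (a * z)\<bar>)"
        by (intro continuous_intros v continuous_on_log_lift_scaled a)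
      have diff: "v (renorm x1 (R \<omega>)) - log_lift v (a * renorm x1 (R \<omega>)) = payoff v y1 \<omega> - payoff v y2 \<omega>"
        if \<omega>: "\<omega> \<in> space M" for \<omega>
      proof -
        define b where "b = s1 * (x1 \<bullet> R \<omega>)"
        have b: "0 < b" using s return_pos[OF x1(1) \<omega>] by (simp add: b_def)
        have z: "b *\<^sub>R renorm x1 (R \<omega>) = y1 * R \<omega>"
          using return_pos[OF x1(1) \<omega>] by (simp add: b_def renorm_def y1_def vec_eq_iff)
        have "b *\<^sub>R (a * renorm x1 (R \<omega>)) = a * (b *\<^sub>R renorm x1 (R \<omega>))" by (simp add: vec_eq_iff)
        also have "\<dots> = y2 * R \<omega>" unfolding z by (simp add: mult.assoc[symmetric] ay)
        finally have az: "b *\<^sub>R (a * renorm x1 (R \<omega>)) = y2 * R \<omega>" .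
        note ren = renorm_R_in_simplex[OF x1(1) \<omega>]
        have p1: "portfolio (renorm x1 (R \<omega>))" by (rule portfolio_simplex[OF ren])
        have p2: "portfolio (a * renorm x1 (R \<omega>))"
          using portfolio_mult[OF p1 a] by (simp add: mult.commute)
        have "payoff v y1 \<omega> = ln b + v (renorm x1 (R \<omega>))"
          using log_lift_scale[OF p1 b, of v] by (simp add: payoff_eq z log_lift_simplex[OF ren])
        moreover have "payoff v y2 \<omega> = ln b + log_lift v (a * renorm x1 (R \<omega>))"
          using log_lift_scale[OF p2 b, of v] by (simp add: payoff_eq az)
        ultimately show ?thesis by simp
      qed
      from AE_space AE_eq show "AE \<omega> in M. \<bar>v (renorm x1 (R \<omega>)) - log_lift v (a * renorm x1 (R \<omega>))\<bar> = 0"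
        by eventually_elim (simp add: diff)
    qed simp
    then show ?thesis by simp
  qed
  have "a $ i = 1" for i
  proof -
    have "a * axis i 1 = (a $ i) *\<^sub>R axis i 1" by (auto simp: vec_eq_iff axis_def)
    then have "v (axis i 1) = ln (a $ i) + v (axis i 1)"
      using eq[OF axis_in_simplex[of i]]
      by (simp add: log_lift_scale[OF portfolio_axis a] log_lift_simplex[OF axis_in_simplex])
    then show ?thesis using a[of i] by simp
  qed
  then have "y1 = y2" using ay by (simp add: vec_eq_iff)
  moreover have "y1 \<bullet> 1 = s1" "y2 \<bullet> 1 = s2"
    using simplexD(2)[OF x1(1)] simplexD(2)[OF x2(1)] by (simp_all add: y1_def y2_def)
  ultimately have "s1 = s2" by simp
  with \<open>y1 = y2\<close> s show "x1 = x2" by (simp add: y1_def y2_def)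
qed

section \<open>Uniqueness of the solution\<close>

text \<open>Take \<open>\<pi>\<close> where \<open>v1 - v2\<close> is maximal and \<open>y\<close> optimal for \<open>v1\<close> at \<open>\<pi>\<close>. Subtracting the inequality
  for \<open>v2\<close> from the equation for \<open>v1\<close>, the trading cost and the return cancel, and what remains
  compares the maximum of \<open>v1 - v2\<close> with its mean after one step.\<close>

lemma bellman_comparison:
  assumes sol: "solves_bellman 0 v1 \<kappa>1" "solves_bellman 0 v2 \<kappa>2"
  obtains \<pi> y m where "\<pi> \<in> prob_simplex" "y \<in> prob_simplex" "J 0 v1 \<pi> y = v1 \<pi> + \<kappa>1"
    "\<And>x. x \<in> prob_simplex \<Longrightarrow> v1 x - v2 x \<le> m"
    "integrable M (\<lambda>\<omega>. m - (v1 (renorm y (R \<omega>)) - v2 (renorm y (R \<omega>))))"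
    "expectation (\<lambda>\<omega>. m - (v1 (renorm y (R \<omega>)) - v2 (renorm y (R \<omega>)))) \<le> \<kappa>2 - \<kappa>1"
proof -
  note v = solves_bellman_continuous[OF sol(1)] solves_bellman_continuous[OF sol(2)]
  have "continuous_on prob_simplex (\<lambda>x. v1 x - v2 x)" by (intro continuous_intros v)
  from continuous_attains_sup[OF compact_prob_simplex prob_simplex_nonempty this]
  obtain \<pi> where \<pi>: "\<pi> \<in> prob_simplex" "\<And>x. x \<in> prob_simplex \<Longrightarrow> v1 x - v2 x \<le> v1 \<pi> - v2 \<pi>" by blast
  obtain y where y: "y \<in> prob_simplex" "J 0 v1 \<pi> y = v1 \<pi> + \<kappa>1"
    using bellman_attained[OF sol(1) \<pi>(1)] by blast
  let ?m = "v1 \<pi> - v2 \<pi>"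
  have eq: "?m - (v1 (renorm y (R \<omega>)) - v2 (renorm y (R \<omega>))) = ?m - (payoff v1 y \<omega> - payoff v2 y \<omega>)" for \<omega>
    by (simp add: payoff_def)
  note i = integrable_payoff(1)[OF v(1) y(1)] integrable_payoff(1)[OF v(2) y(1)]
  have "J 0 v2 \<pi> y \<le> v2 \<pi> + \<kappa>2" by (rule solves_bellman_ge[OF sol(2) \<pi>(1) y(1)])
  then have "?m - (expectation (payoff v1 y) - expectation (payoff v2 y)) \<le> \<kappa>2 - \<kappa>1"
    using y(2) by (simp add: J_def entropic_utility_def)
  then have "expectation (\<lambda>\<omega>. ?m - (v1 (renorm y (R \<omega>)) - v2 (renorm y (R \<omega>)))) \<le> \<kappa>2 - \<kappa>1"
    unfolding eq using i by (simp add: prob_space)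
  moreover have "integrable M (\<lambda>\<omega>. ?m - (v1 (renorm y (R \<omega>)) - v2 (renorm y (R \<omega>))))"
    unfolding eq using i by simp
  ultimately show ?thesis using that \<pi> y by blast
qed

lemma bellman_constant_le:
  assumes sol: "solves_bellman 0 v1 \<kappa>1" "solves_bellman 0 v2 \<kappa>2"
  shows "\<kappa>1 \<le> \<kappa>2"
proof -
  obtain \<pi> y m where \<pi>: "\<pi> \<in> prob_simplex" and y: "y \<in> prob_simplex" "J 0 v1 \<pi> y = v1 \<pi> + \<kappa>1"
    and m: "\<And>x. x \<in> prob_simplex \<Longrightarrow> v1 x - v2 x \<le> m"
    and i: "integrable M (\<lambda>\<omega>. m - (v1 (renorm y (R \<omega>)) - v2 (renorm y (R \<omega>))))"
    and e: "expectation (\<lambda>\<omega>. m - (v1 (renorm y (R \<omega>)) - v2 (renorm y (R \<omega>)))) \<le> \<kappa>2 - \<kappa>1"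
    by (rule bellman_comparison[OF sol]) (rule that)
  have "0 \<le> expectation (\<lambda>\<omega>. m - (v1 (renorm y (R \<omega>)) - v2 (renorm y (R \<omega>))))"
    using m[OF renorm_R_in_simplex[OF y(1)]] by (intro integral_nonneg_AE AE_I2) simp
  with e show ?thesis by linarith
qed

text \<open>With equal constants, the comparison says that \<open>v1 - v2\<close> attains its maximum almost surely after one
  step from \<open>y\<close>. As \<open>y\<close> is an interior point, one step reaches every open subset of the simplex.\<close>

lemma bellman_unique:
  assumes sol: "solves_bellman 0 v1 \<kappa>1" "solves_bellman 0 v2 \<kappa>2" and conc: "has_concave_lift v1"
    and growth: "growth_cond M S \<eta> c h" and full: "full_support_cond M S"
  obtains a where "\<kappa>1 = \<kappa>2" "\<And>x. x \<in> prob_simplex \<Longrightarrow> v1 x = v2 x + a"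
proof -
  have \<kappa>: "\<kappa>1 = \<kappa>2"
    using bellman_constant_le[OF sol] bellman_constant_le[OF sol(2,1)] by simp
  obtain \<pi> y m where \<pi>: "\<pi> \<in> prob_simplex" and y: "y \<in> prob_simplex" "J 0 v1 \<pi> y = v1 \<pi> + \<kappa>1"
    and m: "\<And>x. x \<in> prob_simplex \<Longrightarrow> v1 x - v2 x \<le> m"
    and i: "integrable M (\<lambda>\<omega>. m - (v1 (renorm y (R \<omega>)) - v2 (renorm y (R \<omega>))))"
    and e: "expectation (\<lambda>\<omega>. m - (v1 (renorm y (R \<omega>)) - v2 (renorm y (R \<omega>)))) \<le> \<kappa>2 - \<kappa>1"
    by (rule bellman_comparison[OF sol]) (rule that)
  let ?g = "\<lambda>x. m - (v1 x - v2 x)"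
  have nn: "AE \<omega> in M. 0 \<le> ?g (renorm y (R \<omega>))"
    using m[OF renorm_R_in_simplex[OF y(1)]] by (intro AE_I2) simp
  have "expectation (\<lambda>\<omega>. ?g (renorm y (R \<omega>))) = 0"
    using e \<kappa> integral_nonneg_AE[OF nn] by simp
  then have AE0: "AE \<omega> in M. ?g (renorm y (R \<omega>)) = 0"
    using integral_nonneg_eq_0_iff_AE[OF i nn] by simp
  have int: "y \<in> open_prob_simplex" by (rule optimiser_interior[OF sol(1) conc growth \<pi> y])
  have cont: "continuous_on prob_simplex ?g"
    by (intro continuous_intros solves_bellman_continuous[OF sol(1)] solves_bellman_continuous[OF sol(2)])
  have "?g x = 0" if "x \<in> prob_simplex" for x
    by (rule full_support_at_waiting_time[OF full int cont _ AE0 that]) (use m in simp)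
  then have "v1 x = v2 x + m" if "x \<in> prob_simplex" for x using that by force
  with \<kappa> that show ?thesis by blast
qed

section \<open>Convergence of the maximisers\<close>

text \<open>The oscillation and Lipschitz bounds do not depend on \<open>g n\<close>, which gives boundedness and
  equicontinuity once the additive constant is fixed.\<close>

lemma bellman_compactness:
  assumes sol: "\<And>n. solves_bellman (g n) (v n) (\<kappa> n)" and 0: "x0 \<in> prob_simplex" "\<And>n. v n x0 = 0"
  obtains v' r where "strict_mono (r :: nat \<Rightarrow> nat)" "continuous_on prob_simplex v'"
    "uniform_limit prob_simplex (\<lambda>n. v (r n)) v' sequentially"
proof -
  define L where "L = c_bar c h / (1 - c_bar c h) / s_bar c h * CARD('d)"
  have L0: "0 \<le> c_bar c h / (1 - c_bar c h) / s_bar c h" using c_bar_range s_bar_range by simp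
  then have "0 \<le> L" unfolding L_def by (rule mult_nonneg_nonneg) simp
  have lip: "v n y - v n x \<le> L * norm (y - x)" if "x \<in> prob_simplex" "y \<in> prob_simplex" for n x y
    using bellman_Lipschitz[OF sol that, of n] mult_left_mono[OF l1_norm_le_norm[of "y - x"] L0]
    by (simp add: L_def mult.assoc)
  obtain v' r where "continuous_on prob_simplex v'" "strict_mono (r :: nat \<Rightarrow> nat)"
    and lim: "\<And>e. 0 < e \<Longrightarrow> \<exists>N. \<forall>n x. n \<ge> N \<and> x \<in> prob_simplex \<longrightarrow> norm (v (r n) x - v' x) < e"
  proof (rule Arzela_Ascoli[OF compact_prob_simplex, of v "- ln (s_bar c h)"])
    show "norm (v n x) \<le> - ln (s_bar c h)" if "x \<in> prob_simplex" for n x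
      using bellman_oscillation[OF sol 0(1) that, of n] bellman_oscillation[OF sol that 0(1), of n] 0(2)[of n]
      by (simp add: abs_le_iff)
    fix x :: "real^'d" and e :: real assume x: "x \<in> prob_simplex" and e: "0 < e"
    have "norm (v n x - v n y) < e" if y: "y \<in> prob_simplex" and n: "norm (x - y) < e / (L + 1)" for n y
    proof -
      have "norm (v n x - v n y) \<le> L * norm (x - y)"
        using lip[OF x y, of n] lip[OF y x, of n] by (simp add: abs_le_iff norm_minus_commute)
      also have "\<dots> \<le> (L + 1) * norm (x - y)" by (simp add: mult_right_mono)
      also have "\<dots> < e" using n \<open>0 \<le> L\<close> by (simp add: pos_less_divide_eq mult.commute)
      finally show ?thesis .
    qed
    moreover have "0 < e / (L + 1)" using e \<open>0 \<le> L\<close> by simp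
    ultimately show "\<exists>d>0. \<forall>n y. y \<in> prob_simplex \<and> norm (x - y) < d \<longrightarrow> norm (v n x - v n y) < e" by blast
  qed blast
  moreover have "uniform_limit prob_simplex (\<lambda>n. v (r n)) v' sequentially"
    unfolding uniform_limit_iff eventually_sequentially dist_norm using lim by blast
  ultimately show ?thesis using that by blast
qed

text \<open>Along a subsequence the normalised value functions \<open>u\<close> and the maximisers converge. The constants
  follow, since \<open>\<kappa> n = J (g n) (u n) \<pi> (x n)\<close> by the normalisation \<open>u n \<pi> = 0\<close>. The limit is a solution
  for \<open>\<gamma> = 0\<close> together with a maximiser; the solution is unique up to a
  constant, which does not move the maximiser, and the maximiser is unique.\<close>

lemma optimiser_subsequence:
  assumes g: "\<And>n. g n \<in> {-1..0}" "g \<longlonglongrightarrow> 0"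
    and sol: "\<And>n. solves_bellman (g n) (v n) (\<kappa> n)" and sol0: "solves_bellman 0 v0 \<kappa>0"
    and conc: "has_concave_lift v0" and growth: "growth_cond M S \<eta> c h" and full: "full_support_cond M S"
    and \<pi>: "\<pi> \<in> prob_simplex"
    and x: "\<And>n. x n \<in> prob_simplex" "\<And>n. J (g n) (v n) \<pi> (x n) = v n \<pi> + \<kappa> n"
    and x0: "x0 \<in> prob_simplex" "J 0 v0 \<pi> x0 = v0 \<pi> + \<kappa>0"
  obtains r where "strict_mono (r :: nat \<Rightarrow> nat)" "(x \<circ> r) \<longlonglongrightarrow> x0"
proof -
  define u where "u n z = v n z + - v n \<pi>" for n z
  have solu: "solves_bellman (g n) (u n) (\<kappa> n)" for n
    unfolding u_def[abs_def] using g(1)[of n] by (intro solves_bellman_shift sol) simp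
  have xu: "J (g n) (u n) \<pi> (x n) = u n \<pi> + \<kappa> n" for n
    unfolding u_def[abs_def]
    using J_add_const[OF solves_bellman_continuous[OF sol[of n]] x(1)[of n], of "g n" "- v n \<pi>" \<pi>] x(2)[of n] g(1)[of n]
    by simp
  have u0: "u n \<pi> = 0" for n by (simp add: u_def)
  obtain u' p where p: "strict_mono p" and u': "continuous_on prob_simplex u'"
    and lim: "uniform_limit prob_simplex (\<lambda>n. u (p n)) u' sequentially"
    by (rule bellman_compactness[OF solu \<pi> u0])
  obtain y q where y: "y \<in> prob_simplex" and q: "strict_mono q" "((\<lambda>n. x (p n)) \<circ> q) \<longlonglongrightarrow> y"
    using compact_prob_simplex[unfolded compact_def] x(1) by (meson)
  define r where "r n = p (q n)" for n
  have r: "strict_mono r" using p q(1) by (simp add: r_def strict_mono_def)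
  have xr: "(\<lambda>n. x (r n)) \<longlonglongrightarrow> y" using q(2) by (simp add: comp_def r_def)
  have limr: "uniform_limit prob_simplex (\<lambda>n. u (r n)) u' sequentially"
    using filterlim_compose[OF lim filterlim_subseq[OF q(1)]] by (simp add: r_def)
  have gr: "(\<lambda>n. g (r n)) \<longlonglongrightarrow> 0" using LIMSEQ_subseq_LIMSEQ[OF g(2) r] by (simp add: comp_def)
  have B: "\<bar>u n z\<bar> \<le> - ln (s_bar c h)" if "z \<in> prob_simplex" for n z
    using bellman_oscillation[OF solu \<pi> that, of n] bellman_oscillation[OF solu that \<pi>, of n] u0[of n]
    by (simp add: abs_le_iff)
  have Jlim: "(\<lambda>n. J (g (r n)) (u (r n)) \<pi> (x (r n))) \<longlonglongrightarrow> J 0 u' \<pi> y"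
    by (rule tendsto_J[OF g(1) gr solves_bellman_continuous[OF solu] u' B limr \<pi> x(1) xr])
  have u'0: "u' \<pi> = 0"
    using LIMSEQ_unique[OF tendsto_uniform_limitI[OF limr \<pi>], of 0] by (simp add: u0)
  have \<kappa>lim: "(\<lambda>n. \<kappa> (r n)) \<longlonglongrightarrow> J 0 u' \<pi> y" using Jlim by (simp add: xu u0)
  have sol': "solves_bellman 0 u' (J 0 u' \<pi> y)"
    by (rule bellman_limit(1)[OF g(1) gr solu B limr \<kappa>lim])
  obtain a where a: "\<kappa>0 = J 0 u' \<pi> y" "\<And>z. z \<in> prob_simplex \<Longrightarrow> v0 z = u' z + a"
    using bellman_unique[OF sol0 sol' conc growth full] by blast
  have "J 0 v0 \<pi> y = J 0 (\<lambda>z. u' z + a) \<pi> y"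
    unfolding J_def entropic_utility_def
    using a(2) renorm_R_in_simplex[OF y]
    by (auto simp: payoff_def intro!: Bochner_Integration.integral_cong)
  also have "\<dots> = J 0 u' \<pi> y + a" by (rule J_add_const[OF u' y]) simp
  finally have "J 0 v0 \<pi> y = v0 \<pi> + \<kappa>0" using a \<pi> u'0 by simp
  then have "y = x0" by (rule optimiser_unique[OF sol0 conc growth full \<pi> y _ x0])
  with r xr that show ?thesis by (auto simp: comp_def)
qed

lemma argmax_attains:
  assumes sol: "solves_bellman g v \<kappa>" and \<pi>: "\<pi> \<in> prob_simplex"
    and arg: "is_arg_max (bellman_objective M S \<eta> c h g v lam \<pi>) (\<lambda>y. y \<in> prob_simplex) x"
  shows "x \<in> prob_simplex" "J g v \<pi> x = v \<pi> + \<kappa>"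
proof -
  show x: "x \<in> prob_simplex" using arg by (simp add: is_arg_max_def)
  have "J g v \<pi> y \<le> J g v \<pi> x" if "y \<in> prob_simplex" for y
    using arg that by (force simp: is_arg_max_def bellman_objective_eq not_less)
  then have "v \<pi> + \<kappa> \<le> J g v \<pi> x" by (rule solves_bellman_least[OF sol \<pi>])
  with solves_bellman_ge[OF sol \<pi> x] show "J g v \<pi> x = v \<pi> + \<kappa>" by simp
qed

end

theorem theorem4p5:
  fixes M :: "'a measure"
    and S :: "real \<Rightarrow> 'a \<Rightarrow> real^'d"
    and \<eta> :: "nat \<Rightarrow> 'a \<Rightarrow> real"
    and c h :: "real^'d"
    and v :: "real \<Rightarrow> real^'d \<Rightarrow> real"
    and lam :: "real \<Rightarrow> real"
    and \<pi> :: "real^'d"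
    and opt :: "real \<Rightarrow> real^'d"
  assumes "market M S \<eta>"
    and "\<And>i. c $ i \<in> {0..<1}"
    and "\<And>i. h $ i \<in> {0..<1}"
    and "increments_cond M S"
    and "waiting_times_cond M \<eta>"
    and "square_integrability_cond M S \<eta>"
    and "full_support_cond M S"
    and "growth_cond M S \<eta> c h"
    and "\<pi> \<in> prob_simplex"
    and "\<And>\<gamma>. \<gamma> \<le> 0 \<Longrightarrow> bellman_solution M S \<eta> c h \<gamma> (v \<gamma>) (lam \<gamma>)"
    and "\<And>\<gamma>. \<gamma> \<le> 0 \<Longrightarrow> has_concave_lift (v \<gamma>)"
    and "\<And>\<gamma>. \<gamma> \<le> 0 \<Longrightarrow>
           is_arg_max (bellman_objective M S \<eta> c h \<gamma> (v \<gamma>) (lam \<gamma>) \<pi>)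
                      (\<lambda>\<pi>'. \<pi>' \<in> prob_simplex) (opt \<gamma>)"
  shows "(opt \<longlongrightarrow> opt 0) (at_left 0)"
proof -
  interpret rebalancing M S \<eta> c h
    using assms(1-4,6)
    by (simp add: rebalancing_def rebalancing_axioms_def priced_market_def priced_market_axioms_def
        transaction_costs_def)
  define \<kappa> where "\<kappa> \<gamma> = lam \<gamma> * expectation (\<eta> 1)" for \<gamma>
  have sol: "solves_bellman \<gamma> (v \<gamma>) (\<kappa> \<gamma>)" if "\<gamma> \<le> 0" for \<gamma>
    unfolding \<kappa>_def by (rule bellman_solution_imp_solves[OF assms(10)[OF that] that])
  have opt: "opt \<gamma> \<in> prob_simplex" "J \<gamma> (v \<gamma>) \<pi> (opt \<gamma>) = v \<gamma> \<pi> + \<kappa> \<gamma>" if "\<gamma> \<le> 0" for \<gamma>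
    by (rule argmax_attains[OF sol[OF that] assms(9) assms(12)[OF that]])+
  have sub: "\<exists>r :: nat \<Rightarrow> nat. strict_mono r \<and> (\<lambda>n. opt (g (r n))) \<longlonglongrightarrow> opt 0"
    if g: "\<And>n. g n \<in> {-1..0}" "g \<longlonglongrightarrow> 0" for g
  proof -
    have le: "g n \<le> 0" for n using g(1)[of n] by simp
    obtain r where "strict_mono (r :: nat \<Rightarrow> nat)" "((\<lambda>n. opt (g n)) \<circ> r) \<longlonglongrightarrow> opt 0"
      by (rule optimiser_subsequence[of g "\<lambda>n. v (g n)" "\<lambda>n. \<kappa> (g n)" "v 0" "\<kappa> 0" \<pi> "\<lambda>n. opt (g n)" "opt 0"])
         (use g le sol opt assms(7-9) assms(11)[of 0] in auto)
    then show ?thesis by (auto simp: comp_def)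
  qed
  show ?thesis
  proof (rule tendstoI, rule ccontr)
    fix e :: real assume "0 < e" and not: "\<not> (\<forall>\<^sub>F \<gamma> in at_left 0. dist (opt \<gamma>) (opt 0) < e)"
    \<comment> \<open>A sequence along which convergence fails has no subsequence along which it holds.\<close>
    have "\<exists>\<gamma>. - 1 / real (Suc n) < \<gamma> \<and> \<gamma> < 0 \<and> e \<le> dist (opt \<gamma>) (opt 0)" for n
    proof (rule ccontr)
      assume "\<not> ?thesis"
      then have "\<forall>\<gamma>>- 1 / real (Suc n). \<gamma> < 0 \<longrightarrow> dist (opt \<gamma>) (opt 0) < e" by (auto simp: not_le)
      moreover have "- 1 / real (Suc n) < 0" by simp
      ultimately have "\<forall>\<^sub>F \<gamma> in at_left 0. dist (opt \<gamma>) (opt 0) < e"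
        unfolding eventually_at_left_field by blast
      with not show False by simp
    qed
    then obtain g where g: "\<And>n. - 1 / real (Suc n) < g n" "\<And>n. g n < 0" "\<And>n. e \<le> dist (opt (g n)) (opt 0)"
      by metis
    have "g n \<in> {-1..0}" for n
    proof -
      have "- 1 \<le> - 1 / real (Suc n)" by simp
      with g(1)[of n] have "- 1 < g n" by (rule le_less_trans[rotated])
      with g(2)[of n] show ?thesis by simp
    qed
    moreover have "g \<longlonglongrightarrow> 0"
    proof (rule tendsto_sandwich[of "\<lambda>n. - (1 / real (Suc n))" g _ "\<lambda>_. 0"])
      show "(\<lambda>n. - (1 / real (Suc n))) \<longlonglongrightarrow> 0"
        using tendsto_minus[OF LIMSEQ_Suc[OF lim_1_over_n]] by simp
      show "\<forall>\<^sub>F n in sequentially. - (1 / real (Suc n)) \<le> g n"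
        using g(1) by (intro always_eventually) (simp add: less_imp_le)
      show "\<forall>\<^sub>F n in sequentially. g n \<le> 0"
        using g(2) by (intro always_eventually) (simp add: less_imp_le)
    qed simp
    ultimately obtain r where "(\<lambda>n. opt (g (r n))) \<longlonglongrightarrow> opt 0" using sub by blast
    from tendstoD[OF this \<open>0 < e\<close>] have "\<forall>\<^sub>F n in sequentially. dist (opt (g (r n))) (opt 0) < e" .
    then show False using g(3) by (auto simp: eventually_sequentially not_less[symmetric])
  qed
qed


end
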